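(* Let $G=(V,E,w)$ be a weighted graph. Suppose that for some $x_0\in V$, $\alpha>0$ and $C>0$, $$\mu(B_R(x_0))\leq C(1+R)^{\alpha},\quad \text{for all real } R\geq 1.$$ Then for all real $k\geq 1$, $$\dim \mathcal{P}_{2k}(G)\leq (k+1)\dim \mathcal{H}_{2k}(G).$$
   Context: A weighted graph $G=(V,E,w)$ consists of a locally finite, simple, undirected, connected graph $(V,E)$ and an edge weight function $w:E\to(0,\infty)$, $\{x,y\}\mapsto w_{xy}=w_{yx}$. Vertices $x,y$ are neighbours, $x\sim y$, if $\{x,y\}\in E$. The combinatorial distance is $d(x,y)=\inf\{n : x=z_0\sim z_1\sim\cdots\sim z_n=y\}$, and $B_R(x)=\{y\in V: d(y,x)\leq R\}$ for $R>0$. The weighted vertex degree is $\mu_x=\sum_{y\in V: y\sim x}w_{xy}$, and $\mu(\Omega)=\sum_{x\in\Omega}\mu_x$ for $\Omega\subset V$. The Laplacian of $f:V\to\mathbb{R}$ is $\Delta f(x)=\sum_{y\in V: y\sim x}\frac{w_{xy}}{\mu_x}(f(y)-f(x))$, and $f$ is harmonic if $\Delta f=0$ on $V$. Let $\mathbb{R}_-=(-\infty,0]$. A function $u(x,t)$ on $V\times\mathbb{R}_-$ is an ancient solution to the heat equation if $\partial_t u(x,t)=\Delta u(x,t)$ for all $x\in V$, $t\in\mathbb{R}_-$ (with $\Delta$ acting in $x$). For $k>0$, $\mathcal{H}_k(G)$ is the space of harmonic functions $f:V\to\mathbb{R}$ for which there are some $x_0\in V$ and a constant $C_f$ such that $\sup_{x\in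 B_R(x_0)}|f(x)|\leq C_f(1+R)^k$ for all $R\geq 1$. For $k>0$, $\mathcal{P}_k(G)$ is the space of ancient solutions $u:V\times\mathbb{R}_-\to\mathbb{R}$ of the heat equation for which there are some $x_0\in V$ and a constant $C_u$ such that $\sup_{(x,t)\in B_R(x_0)\times[-R^2,0]}|u(x,t)|\leq C_u(1+R)^k$ for all $R\geq 1$. Both are real vector spaces and $\dim$ denotes the (possibly infinite) dimension. *)

theory Defs
  imports "HOL-Analysis.Analysis" "HOL-Library.Function_Algebras"
begin

(* Pointwise real vector space structure on functions.  Iterating the instance covers
   functions of type 'v => real => real, so that span and dim of the library apply. *)

instantiation "fun" :: (type, real_vector) real_vector
begin

definition scaleR_fun_def: "scaleR c f = (\<lambda>x. c *\<^sub>R f x)"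

instance
  by standard (auto simp: scaleR_fun_def fun_eq_iff scaleR_add_right scaleR_add_left)

end

(* The vertex set is the whole type 'v; an edge is a two-element set {x, y}. *)

definition adj :: "'v set set \<Rightarrow> 'v \<Rightarrow> 'v \<Rightarrow> bool" where
  "adj E x y \<longleftrightarrow> {x, y} \<in> E"

definition is_walk :: "'v set set \<Rightarrow> nat \<Rightarrow> (nat \<Rightarrow> 'v) \<Rightarrow> 'v \<Rightarrow> 'v \<Rightarrow> bool" where
  "is_walk E n z x y \<longleftrightarrow> z 0 = x \<and> z n = y \<and> (\<forall>i<n. adj E (z i) (z (Suc i)))"

locale weighted_graph =
  fixes E :: "'v set set" and w :: "'v set \<Rightarrow> real"
  assumes simple: "\<And>e. e \<in> E \<Longrightarrow> \<exists>x y. x \<noteq> y \<and> e = {x, y}"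
    and locally_finite: "\<And>x. finite {y. adj E x y}"
    and connected: "\<And>x y. \<exists>n z. is_walk E n z x y"
    and weight_pos: "\<And>e. e \<in> E \<Longrightarrow> w e > 0"

definition gdist :: "'v set set \<Rightarrow> 'v \<Rightarrow> 'v \<Rightarrow> nat" where
  "gdist E x y = Inf {n. \<exists>z. is_walk E n z x y}"

definition gball :: "'v set set \<Rightarrow> 'v \<Rightarrow> real \<Rightarrow> 'v set" where
  "gball E x R = {y. real (gdist E y x) \<le> R}"

definition vdeg :: "'v set set \<Rightarrow> ('v set \<Rightarrow> real) \<Rightarrow> 'v \<Rightarrow> real" where
  "vdeg E w x = (\<Sum>y | adj E x y. w {x, y})"

(* Valued in the extended nonnegative reals, so that it is meaningful for infinite \<Omega> too. *)
definition vol :: "'v set set \<Rightarrow> ('v set \<Rightarrow> real) \<Rightarrow> 'v set \<Rightarrow> ennreal" where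
  "vol E w \<Omega> = (\<Sum>\<^sub>\<infinity>x\<in>\<Omega>. ennreal (vdeg E w x))"

definition laplacian :: "'v set set \<Rightarrow> ('v set \<Rightarrow> real) \<Rightarrow> ('v \<Rightarrow> real) \<Rightarrow> 'v \<Rightarrow> real" where
  "laplacian E w f x = (\<Sum>y | adj E x y. w {x, y} / vdeg E w x * (f y - f x))"

definition harmonic :: "'v set set \<Rightarrow> ('v set \<Rightarrow> real) \<Rightarrow> ('v \<Rightarrow> real) \<Rightarrow> bool" where
  "harmonic E w f \<longleftrightarrow> (\<forall>x. laplacian E w f x = 0)"

(* At t = 0 the derivative within {..0} is the one-sided (left) derivative. *)
definition ancient_solution ::
    "'v set set \<Rightarrow> ('v set \<Rightarrow> real) \<Rightarrow> ('v \<Rightarrow> real \<Rightarrow> real) \<Rightarrow> bool" where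
  "ancient_solution E w u \<longleftrightarrow>
     (\<forall>x. \<forall>t\<le>0. (u x has_real_derivative laplacian E w (\<lambda>y. u y t) x) (at t within {..0}))"

(* The suprema in the growth conditions are taken in ereal, so that they are genuine
   suprema even for unbounded functions. *)

definition harmonic_space ::
    "'v set set \<Rightarrow> ('v set \<Rightarrow> real) \<Rightarrow> real \<Rightarrow> ('v \<Rightarrow> real) set" where
  "harmonic_space E w k =
     {f. harmonic E w f \<and>
         (\<exists>x0 C. \<forall>R\<ge>1. (SUP x\<in>gball E x0 R. ereal \<bar>f x\<bar>) \<le> ereal (C * (1 + R) powr k))}"

(* A function on V \<times> (-\<infinity>, 0] is represented by its extension by 0 to positive times; without
   such a normalization the irrelevant values at t > 0 would contribute to the dimension. *)
definition ancient_space ::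
    "'v set set \<Rightarrow> ('v set \<Rightarrow> real) \<Rightarrow> real \<Rightarrow> ('v \<Rightarrow> real \<Rightarrow> real) set" where
  "ancient_space E w k =
     {u. (\<forall>x. \<forall>t>0. u x t = 0) \<and> ancient_solution E w u \<and>
         (\<exists>x0 C. \<forall>R\<ge>1. (SUP (x, t)\<in>gball E x0 R \<times> {- (R\<^sup>2)..0}. ereal \<bar>u x t\<bar>)
                        \<le> ereal (C * (1 + R) powr k))}"

(* The library's dim is 0 on infinite-dimensional spaces. *)
definition edim :: "'a::real_vector set \<Rightarrow> enat" where
  "edim S = (if \<exists>B. finite B \<and> S \<subseteq> span B then enat (dim S) else \<infinity>)"

end

theory Submission
  imports Defs
begin

text \<open>Let \<open>u\<close> be an ancient solution of polynomial growth, so that \<open>\<Delta> ^ i u\<close> is its \<open>i\<close>-th time derivative.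
  Consider the energies \<open>E\<^sub>j\<close> of \<open>u\<close>: the \<open>L\<^sup>2\<close> norms and the Dirichlet energies of the functions
  \<open>\<Delta> ^ i u\<close>, localized to balls of radius comparable to \<open>R\<close>. Along the heat flow each \<open>E\<^sub>j\<close> decreases
  at a rate \<open>E\<^sub>j\<^sub>+\<^sub>1 / 2\<close>, up to an error \<open>4 * E\<^sub>j / R\<^sup>2\<close> taken on a slightly larger ball
  (\<open>energy_deriv\<close>). Therefore a combination of the \<open>s ^ j * E\<^sub>j\<close>, with \<open>s \<le> R\<^sup>2\<close> the time elapsed, has
  derivative at most \<open>4 * E\<^sub>0 / R\<^sup>2\<close> (\<open>functional_deriv\<close>), and after time \<open>R\<^sup>2\<close> one finds that
  \<open>R ^ (2 * n) * E\<^sub>n\<close> is bounded by a constant times the supremum of \<open>E\<^sub>0\<close>. Volume and solution grow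
  polynomially, so the right side is at most a power of \<open>R\<close> that does not depend on \<open>n\<close>. Hence
  \<open>\<Delta> ^ m u = 0\<close> for large \<open>m\<close> (\<open>lap_pow_eq_zero\<close>). Only pointwise monotonicity in time is used,
  no integration over space-time.

  Consequently \<open>u\<close> is a polynomial in time with coefficients \<open>\<Delta> ^ j f / j!\<close>, where \<open>f\<close> is its value at
  time zero (\<open>ancient_eq_polynomial\<close>). For fixed \<open>x\<close> the growth \<open>\<bar>u x (- R\<^sup>2)\<bar> \<le> C * (1 + R) powr (2 * k)\<close>
  excludes powers of \<open>t\<close> above \<open>k\<close>, so \<open>\<Delta> ^ n f = 0\<close> with \<open>n = \<lfloor>k\<rfloor> + 1\<close>, and \<open>u\<close> is the image of \<open>f\<close>
  under a linear map (\<open>ancient_space_subset\<close>).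

  It remains to count dimensions. The Laplacian maps the functions of growth \<open>2 * k\<close> to themselves,
  and its kernel there consists of harmonic functions of growth \<open>2 * k\<close>. The kernel of its \<open>n\<close>-th
  power has at most \<open>n\<close> times the dimension of its kernel (\<open>span_iterated_kernel\<close>), and \<open>n \<le> k + 1\<close>.\<close>

section \<open>Counting dimensions\<close>

text \<open>Rank-nullity as a bound on spanning sets. In this form the ambient spaces may be infinite-dimensional.\<close>

lemma span_kernel_and_image:
  fixes T :: "'a::real_vector \<Rightarrow> 'b::real_vector"
  assumes T: "linear T" and S: "subspace S" and "finite A" "finite B"
    and ker: "{x \<in> S. T x = 0} \<subseteq> span A" and im: "T ` S \<subseteq> span B"
  shows "\<exists>C. finite C \<and> card C \<le> card A + card B \<and> S \<subseteq> span C"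
proof -
  obtain D where D: "D \<subseteq> T ` S" "independent D" "T ` S \<subseteq> span D"
    using maximal_independent_subset by blast
  have finD: "finite D" and cardD: "card D \<le> card B"
    using independent_span_bound[OF \<open>finite B\<close> D(2)] D(1) im by auto
  define g where "g = inv_into S T"
  have g: "g d \<in> S" "T (g d) = d" if "d \<in> D" for d
    using that D(1) by (auto simp: g_def inv_into_into f_inv_into_f)
  have "S \<subseteq> span (A \<union> g ` D)"
  proof
    fix s assume s: "s \<in> S"
    have "T ` g ` D = D"
      using g(2) by force
    then have "T s \<in> T ` span (g ` D)"
      using s D(3) linear_span_image[OF T, of "g ` D"] by auto
    then obtain c where c: "c \<in> span (g ` D)" "T s = T c"
      by blast
    have "span (g ` D) \<subseteq> S"
      using g(1) by (intro span_minimal S) auto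
    with c(1) have "s - c \<in> S"
      using S s by (auto intro: subspace_diff)
    moreover have "T (s - c) = 0"
      using T c(2) by (simp add: linear_diff)
    ultimately have "s - c \<in> span A"
      using ker by auto
    then have "(s - c) + c \<in> span (A \<union> g ` D)"
      using c(1) by (intro span_add) (meson span_mono subsetD Un_upper1 Un_upper2)+
    then show "s \<in> span (A \<union> g ` D)"
      by simp
  qed
  moreover have "card (A \<union> g ` D) \<le> card A + card B"
    using card_Un_le[of A "g ` D"] card_image_le[OF finD, of g] cardD by linarith
  ultimately show ?thesis
    using \<open>finite A\<close> finD by blast
qed

lemma linear_funpow:
  fixes T :: "'a::real_vector \<Rightarrow> 'a"
  assumes "linear T"
  shows "linear (T ^^ n)"
proof (induction n)
  case 0
  show ?case by (simp add: linear_id[unfolded id_def] id_def)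
next
  case (Suc n)
  then show ?case
    using linear_compose[OF Suc assms] by (simp add: comp_def)
qed

text \<open>If \<open>T\<close> preserves \<open>G\<close>, it maps the kernel of \<open>T ^^ Suc n\<close> on \<open>G\<close> into that of \<open>T ^^ n\<close>, and what it
  annihilates lies in its own kernel; so each further power of \<open>T\<close> costs at most one more copy of
  \<open>card A\<close>.\<close>

lemma span_iterated_kernel:
  fixes T :: "'a::real_vector \<Rightarrow> 'a"
  assumes T: "linear T" and G: "subspace G" and inv: "T ` G \<subseteq> G"
    and A: "finite A" "{f \<in> G. T f = 0} \<subseteq> span A"
  shows "\<exists>C. finite C \<and> card C \<le> n * card A \<and> {f \<in> G. (T ^^ n) f = 0} \<subseteq> span C"
proof (induction n)
  case 0
  show ?case
    by (intro exI[of _ "{}"]) auto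
next
  case (Suc n)
  then obtain C where C: "finite C" "card C \<le> n * card A" "{f \<in> G. (T ^^ n) f = 0} \<subseteq> span C"
    by blast
  let ?S = "{f \<in> G. (T ^^ Suc n) f = 0}"
  have "subspace ?S"
  proof -
    have "?S = G \<inter> {f. (T ^^ Suc n) f = 0}"
      by blast
    then show ?thesis
      using subspace_inter[OF G linear_subspace_kernel[OF linear_funpow[OF T, of "Suc n"]]] by simp
  qed
  moreover have "T ` ?S \<subseteq> span C"
  proof
    fix h assume "h \<in> T ` ?S"
    then obtain f where "f \<in> G" "(T ^^ Suc n) f = 0" "h = T f"
      by blast
    then show "h \<in> span C"
      using C(3) inv by (auto simp: funpow_swap1)
  qed
  moreover have "{f \<in> ?S. T f = 0} \<subseteq> span A"
    using A(2) by blast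
  ultimately obtain D where "finite D" "card D \<le> card A + card C" "?S \<subseteq> span D"
    using span_kernel_and_image[OF T _ A(1) C(1)] by blast
  moreover have "card A + card C \<le> Suc n * card A"
    using C(2) by simp
  ultimately show ?case
    by (meson le_trans)
qed

lemma edim_le_card:
  assumes "finite B" "S \<subseteq> span B"
  shows "edim S \<le> enat (card B)"
  using assms dim_le_card[OF assms(2,1)] by (auto simp: edim_def)

lemma edim_finite_spanned:
  assumes "edim S = enat n"
  obtains B where "finite B" "card B = n" "S \<subseteq> span B"
proof -
  obtain A where A: "finite A" "S \<subseteq> span A" and n: "n = dim S"
    using assms by (auto simp: edim_def split: if_splits)
  obtain B where B: "B \<subseteq> S" "independent B" "S \<subseteq> span B" "card B = dim S"
    using basis_exists by blast
  then show ?thesis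
    using that[of B] n independent_span_bound[OF A(1) B(2)] A(2) by auto
qed

section \<open>Growth of polynomials\<close>

lemma nonpos_if_power_le_powr:
  fixes K Q q R0 :: real
  assumes bd: "\<And>R. R \<ge> R0 \<Longrightarrow> K * R ^ n \<le> Q * R powr q" and q: "q < real n"
  shows "K \<le> 0"
proof -
  have "((\<lambda>R. Q * R powr (q - real n)) \<longlongrightarrow> Q * 0) at_top"
    by (intro tendsto_intros tendsto_neg_powr filterlim_ident) (use q in auto)
  moreover have "\<forall>\<^sub>F R in at_top. K \<le> Q * R powr (q - real n)"
    using eventually_ge_at_top[of "max R0 1"]
  proof eventually_elim
    case (elim R)
    then have "K * R powr real n \<le> Q * R powr q"
      using bd[of R] by (simp add: powr_realpow)
    then show ?case
      using elim by (simp add: powr_diff field_simps)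
  qed
  ultimately show ?thesis
    using tendsto_lowerbound[of "\<lambda>R. Q * R powr (q - real n)" "Q * 0" at_top K] by simp
qed

text \<open>A polynomial in \<open>t = - R\<^sup>2\<close> that is bounded by a multiple of \<open>(1 + R) powr (2 * k)\<close> has degree at
  most \<open>k\<close>. The coefficients are removed from the top: once the sum is cut at \<open>j = m\<close> with \<open>m > k\<close>,
  its leading term is of order \<open>R ^ (2 * m)\<close>, whereas everything else in the bound is of smaller
  order.\<close>

lemma coeff_zero_above_growth:
  fixes c :: "nat \<Rightarrow> real"
  assumes "\<And>R::real. R \<ge> 1 \<Longrightarrow> \<bar>\<Sum>j<m. c j * (- (R\<^sup>2)) ^ j\<bar> \<le> Q * (1 + R) powr (2 * k)"
    and "j < m" "real j > k" "k \<ge> 0"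
  shows "c j = 0"
  using assms
proof (induction m)
  case 0
  then show ?case by simp
next
  case (Suc m)
  show ?case
  proof (cases "real m > k")
    case False
    then show ?thesis
      using Suc.prems by (meson leD less_Suc_eq_le of_nat_le_iff order.strict_trans2)
  next
    case True
    define L where "L = (\<Sum>j<m. \<bar>c j\<bar>)"
    have Q0: "0 \<le> Q"
    proof -
      have "0 \<le> Q * (1 + 1) powr (2 * k)"
        using Suc.prems(1)[of 1] by (smt (verit))
      then show ?thesis
        by (simp add: zero_le_mult_iff)
    qed
    (* The exponent 2m - 1 majorizes all terms with j < m, so one power function absorbs both
       these terms and the growth bound. *)
    have "\<bar>c m\<bar> \<le> 0"
    proof (rule nonpos_if_power_le_powr)
      show "max (2 * k) (2 * real m - 1) < real (2 * m)"
        using True by simp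
      fix R :: real assume R: "R \<ge> 1"
      have "\<bar>c m\<bar> * R ^ (2 * m) = \<bar>c m * (- (R\<^sup>2)) ^ m\<bar>"
        by (simp add: abs_mult power_abs power_mult)
      also have "\<dots> \<le> \<bar>\<Sum>j<Suc m. c j * (- (R\<^sup>2)) ^ j\<bar> + \<bar>\<Sum>j<m. c j * (- (R\<^sup>2)) ^ j\<bar>"
        by simp
      also have "\<bar>\<Sum>j<m. c j * (- (R\<^sup>2)) ^ j\<bar> \<le> (\<Sum>j<m. \<bar>c j\<bar> * R powr (2 * real m - 1))"
      proof (rule order.trans[OF sum_abs sum_mono])
        fix j assume j: "j \<in> {..<m}"
        have "\<bar>c j * (- (R\<^sup>2)) ^ j\<bar> = \<bar>c j\<bar> * R powr real (2 * j)"
          using R by (subst powr_realpow) (auto simp: abs_mult power_abs power_mult)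
        also have "\<dots> \<le> \<bar>c j\<bar> * R powr (2 * real m - 1)"
          using R j by (intro mult_left_mono powr_mono) auto
        finally show "\<bar>c j * (- (R\<^sup>2)) ^ j\<bar> \<le> \<bar>c j\<bar> * R powr (2 * real m - 1)" .
      qed
      also have "\<dots> = L * R powr (2 * real m - 1)"
        by (simp add: L_def sum_distrib_right)
      also have "\<dots> \<le> L * R powr (max (2 * k) (2 * real m - 1))"
        using R by (intro mult_left_mono powr_mono) (auto simp: L_def sum_nonneg)
      also have "\<bar>\<Sum>j<Suc m. c j * (- (R\<^sup>2)) ^ j\<bar> \<le> Q * (1 + R) powr (2 * k)"
        using Suc.prems(1) R by blast
      also have "\<dots> \<le> Q * (2 * R) powr (2 * k)"
        using R Q0 Suc.prems by (intro mult_left_mono powr_mono2) auto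
      also have "\<dots> = Q * 2 powr (2 * k) * R powr (2 * k)"
        using R by (simp add: powr_mult)
      also have "\<dots> \<le> Q * 2 powr (2 * k) * R powr (max (2 * k) (2 * real m - 1))"
        using R Q0 by (intro mult_left_mono powr_mono) auto
      finally show "\<bar>c m\<bar> * R ^ (2 * m)
          \<le> (Q * 2 powr (2 * k) + L) * R powr (max (2 * k) (2 * real m - 1))"
        by (simp add: algebra_simps)
    qed
    then have cm: "c m = 0"
      by simp
    show ?thesis
    proof (cases "j = m")
      case True
      with cm show ?thesis by simp
    next
      case False
      then show ?thesis
        using Suc.IH Suc.prems cm by (simp add: less_Suc_eq)
    qed
  qed
qed

section \<open>Distances and balls\<close>

context weighted_graph
begin

lemma adj_commute: "adj E x y \<longleftrightarrow> adj E y x"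
  by (simp add: adj_def insert_commute)

lemma gdist_le: "is_walk E n z x y \<Longrightarrow> gdist E x y \<le> n"
  unfolding gdist_def by (rule cInf_lower) auto

lemma gdist_walk: "\<exists>z. is_walk E (gdist E x y) z x y"
proof -
  have "gdist E x y \<in> {n. \<exists>z. is_walk E n z x y}"
    unfolding gdist_def by (rule Inf_nat_def1) (use connected in auto)
  then show ?thesis by simp
qed

lemma gdist_self [simp]: "gdist E x x = 0"
  using gdist_le[of 0 "\<lambda>_. x" x x] by (simp add: is_walk_def)

lemma walk_append:
  assumes p: "is_walk E m p x y" and q: "is_walk E n q y z"
  shows "is_walk E (m + n) (\<lambda>i. if i \<le> m then p i else q (i - m)) x z"
  unfolding is_walk_def
proof (intro conjI allI impI)
  show "(if 0 \<le> m then p 0 else q (0 - m)) = x"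
    using p by (simp add: is_walk_def)
  show "(if m + n \<le> m then p (m + n) else q (m + n - m)) = z"
    using p q by (cases n) (auto simp: is_walk_def)
  fix i assume "i < m + n"
  consider "i < m" | "i = m" | "i > m" by linarith
  then show "adj E (if i \<le> m then p i else q (i - m)) (if Suc i \<le> m then p (Suc i) else q (Suc i - m))"
  proof cases
    case 1
    then show ?thesis
      using p by (simp add: is_walk_def)
  next
    case 2
    then have "n > 0"
      using \<open>i < m + n\<close> by simp
    then have "q 0 = p m" "adj E (q 0) (q (Suc 0))"
      using p q by (auto simp: is_walk_def)
    with 2 show ?thesis
      by (simp add: Suc_diff_le)
  next
    case 3
    then have "i - m < n" "Suc i - m = Suc (i - m)"
      using \<open>i < m + n\<close> by linarith+
    with 3 q show ?thesis
      by (simp add: is_walk_def)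
  qed
qed

lemma gdist_triangle: "gdist E x z \<le> gdist E x y + gdist E y z"
proof -
  obtain p where p: "is_walk E (gdist E x y) p x y"
    using gdist_walk[of x y] by (rule exE)
  obtain q where q: "is_walk E (gdist E y z) q y z"
    using gdist_walk[of y z] by (rule exE)
  from gdist_le[OF walk_append[OF p q]] show ?thesis .
qed

lemma gdist_adj: "adj E x y \<Longrightarrow> gdist E x z \<le> Suc (gdist E y z)"
proof -
  assume "adj E x y"
  then have "is_walk E 1 (\<lambda>i. if i = 0 then x else y) x y"
    by (simp add: is_walk_def)
  from gdist_le[OF this] gdist_triangle[of x z y] show ?thesis
    by linarith
qed

lemma finite_gball: "finite (gball E x R)"
proof -
  have fin: "finite {y. gdist E y x \<le> n}" for n
  proof (induction n)
    case 0
    have "y = x" if y: "gdist E y x = 0" for y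
    proof -
      obtain z where "is_walk E 0 z y x"
        using gdist_walk[of y x] y by auto
      then show ?thesis
        by (auto simp: is_walk_def)
    qed
    then have "{y. gdist E y x \<le> 0} \<subseteq> {x}"
      by auto
    then show ?case
      using finite_subset by blast
  next
    case (Suc n)
    let ?B = "{y. gdist E y x \<le> n}"
    have "{y. gdist E y x \<le> Suc n} \<subseteq> ?B \<union> (\<Union>z\<in>?B. {y. adj E z y})"
    proof
      fix y assume "y \<in> {y. gdist E y x \<le> Suc n}"
      then have le: "gdist E y x \<le> Suc n" by simp
      obtain z where z: "is_walk E (gdist E y x) z y x"
        using gdist_walk[of y x] by (rule exE)
      show "y \<in> ?B \<union> (\<Union>z\<in>?B. {y. adj E z y})"
      proof (cases "gdist E y x")
        case 0
        then show ?thesis by simp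
      next
        case (Suc k)
        then have "is_walk E k (\<lambda>i. z (Suc i)) (z 1) x" "adj E y (z 1)"
          using z by (auto simp: is_walk_def)
        moreover from gdist_le[OF this(1)] have "gdist E (z 1) x \<le> n"
          using le Suc by simp
        ultimately show ?thesis
          using adj_commute[of y "z 1"] by blast
      qed
    qed
    moreover have "finite (?B \<union> (\<Union>z\<in>?B. {y. adj E z y}))"
      using Suc locally_finite by simp
    ultimately show ?case
      using finite_subset by blast
  qed
  have "gball E x R \<subseteq> {y. gdist E y x \<le> nat \<lfloor>R\<rfloor>}"
    by (auto simp: gball_def le_nat_floor)
  then show ?thesis
    using fin finite_subset by blast
qed

section \<open>The Laplacian\<close>

text \<open>The weight extended by zero to all pairs of vertices, so that double sums over a finite vertex set
  can be symmetrized freely.\<close>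

definition wt :: "'v \<Rightarrow> 'v \<Rightarrow> real" where
  "wt x y = (if adj E x y then w {x, y} else 0)"

lemma wt_commute: "wt x y = wt y x"
  by (simp add: wt_def adj_commute[of x] insert_commute)

lemma wt_nonneg: "wt x y \<ge> 0"
  using weight_pos[of "{x, y}"] by (auto simp: wt_def adj_def)

lemma vdeg_nonneg: "vdeg E w x \<ge> 0"
  unfolding vdeg_def using weight_pos by (intro sum_nonneg) (auto simp: adj_def less_imp_le)

lemma vdeg_pos: "adj E x y \<Longrightarrow> vdeg E w x > 0"
  unfolding vdeg_def using weight_pos
  by (intro sum_pos locally_finite) (auto simp: adj_def)

lemma sum_wt_nbrs:
  assumes "finite S" "{y. adj E x y} \<subseteq> S"
  shows "(\<Sum>y\<in>S. wt x y * h y) = (\<Sum>y | adj E x y. w {x, y} * h y)"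
proof -
  have "(\<Sum>y\<in>S. wt x y * h y) = (\<Sum>y | adj E x y. wt x y * h y)"
    using assms by (intro sum.mono_neutral_right) (auto simp: wt_def)
  then show ?thesis
    by (simp add: wt_def)
qed

lemma sum_wt_le_vdeg:
  assumes "finite S"
  shows "(\<Sum>y\<in>S. wt x y) \<le> vdeg E w x"
proof -
  have "(\<Sum>y\<in>S. wt x y) \<le> (\<Sum>y\<in>S \<union> {y. adj E x y}. wt x y)"
    using assms locally_finite wt_nonneg by (intro sum_mono2) auto
  also have "\<dots> = vdeg E w x"
    using sum_wt_nbrs[of "S \<union> {y. adj E x y}" x "\<lambda>_. 1"] assms locally_finite
    by (simp add: vdeg_def)
  finally show ?thesis .
qed

lemma vdeg_laplacian:
  assumes "finite S" "{y. adj E x y} \<subseteq> S"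
  shows "vdeg E w x * laplacian E w f x = (\<Sum>y\<in>S. wt x y * (f y - f x))"
proof (cases "vdeg E w x = 0")
  case True
  then have "{y. adj E x y} = {}"
    using vdeg_pos[of x] by auto
  then show ?thesis
    using sum_wt_nbrs[OF assms, of "\<lambda>y. f y - f x"] by (simp add: True)
next
  case False
  then show ?thesis
    unfolding sum_wt_nbrs[OF assms, of "\<lambda>y. f y - f x"] by (simp add: laplacian_def sum_distrib_left)
qed

lemma linear_laplacian: "linear (laplacian E w)"
proof (rule linearI)
  show "laplacian E w (f + g) = laplacian E w f + laplacian E w g" for f g
    by (auto simp: laplacian_def fun_eq_iff sum.distrib[symmetric] algebra_simps intro!: sum.cong)
      (simp add: add_divide_distrib diff_divide_distrib)
  show "laplacian E w (c *\<^sub>R f) = c *\<^sub>R laplacian E w f" for c f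
    by (simp add: laplacian_def fun_eq_iff scaleR_fun_def sum_distrib_left algebra_simps)
qed

lemma abs_laplacian_le:
  assumes "\<And>y. adj E x y \<Longrightarrow> \<bar>f y\<bar> \<le> M" "\<bar>f x\<bar> \<le> M"
  shows "\<bar>laplacian E w f x\<bar> \<le> 2 * M"
proof (cases "vdeg E w x = 0")
  case True
  then show ?thesis
    using assms(2) by (simp add: laplacian_def)
next
  case False
  have "\<bar>laplacian E w f x\<bar> \<le> (\<Sum>y | adj E x y. w {x, y} / vdeg E w x * (2 * M))"
    unfolding laplacian_def
  proof (rule order.trans[OF sum_abs sum_mono])
    fix y assume "y \<in> {y. adj E x y}"
    then have "w {x, y} > 0" "\<bar>f y\<bar> \<le> M"
      using weight_pos assms(1) by (auto simp: adj_def)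
    moreover from this have "\<bar>f y - f x\<bar> \<le> 2 * M"
      using assms(2) by linarith
    ultimately
    show "\<bar>w {x, y} / vdeg E w x * (f y - f x)\<bar> \<le> w {x, y} / vdeg E w x * (2 * M)"
      using vdeg_nonneg[of x] by (simp add: abs_mult mult_left_mono divide_right_mono)
  qed
  also have "\<dots> = 2 * M"
    using False by (simp add: vdeg_def flip: sum_distrib_right sum_divide_distrib)
  finally show ?thesis .
qed

text \<open>The Laplacian is the weighted mean of the differences \<open>f y - f x\<close>; the inequality is the
  nonnegativity of the variance of these differences.\<close>

lemma laplacian_square_le:
  assumes "finite S" "{y. adj E x y} \<subseteq> S"
  shows "vdeg E w x * (laplacian E w f x)\<^sup>2 \<le> (\<Sum>y\<in>S. wt x y * (f y - f x)\<^sup>2)"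
proof (cases "vdeg E w x = 0")
  case True
  then show ?thesis
    by (simp add: sum_nonneg wt_nonneg)
next
  case False
  let ?\<mu> = "vdeg E w x" and ?g = "laplacian E w f x"
  have \<mu>: "(\<Sum>y\<in>S. wt x y) = ?\<mu>"
    using sum_wt_nbrs[OF assms, of "\<lambda>_. 1"] by (simp add: vdeg_def)
  have "0 \<le> (\<Sum>y\<in>S. wt x y * (f y - f x - ?g)\<^sup>2)"
    by (simp add: sum_nonneg wt_nonneg)
  also have "\<dots> = (\<Sum>y\<in>S. wt x y * (f y - f x)\<^sup>2) - 2 * ?g * (\<Sum>y\<in>S. wt x y * (f y - f x))
      + ?g\<^sup>2 * (\<Sum>y\<in>S. wt x y)"
    by (simp add: sum_distrib_left sum_subtractf sum.distrib power2_eq_square algebra_simps)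
  also have "\<dots> = (\<Sum>y\<in>S. wt x y * (f y - f x)\<^sup>2) - ?\<mu> * ?g\<^sup>2"
    unfolding \<mu> vdeg_laplacian[OF assms, symmetric] by (simp add: power2_eq_square algebra_simps)
  finally show ?thesis
    by simp
qed

end

section \<open>Two summations by parts\<close>

lemma sum_sum_swap:
  assumes "\<And>x y. F x y = F' y x"
  shows "(\<Sum>x\<in>S. \<Sum>y\<in>S. F x y) = (\<Sum>x\<in>S. \<Sum>y\<in>S. F' x y)"
  by (subst sum.swap) (simp add: assms)

lemma sum_by_parts:
  fixes W :: "'a \<Rightarrow> 'a \<Rightarrow> real"
  assumes "\<And>x y. W x y = W y x"
  shows "(\<Sum>x\<in>S. \<Sum>y\<in>S. W x y * a x * (v y - v x))
       = - (1/2) * (\<Sum>x\<in>S. \<Sum>y\<in>S. W x y * (a y - a x) * (v y - v x))"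
proof -
  have "(\<Sum>x\<in>S. \<Sum>y\<in>S. W x y * a y * (v y - v x)) = (\<Sum>x\<in>S. \<Sum>y\<in>S. W y x * a x * (v x - v y))"
    by (rule sum.swap)
  also have "\<dots> = (\<Sum>x\<in>S. \<Sum>y\<in>S. - (W x y * a x * (v y - v x)))"
    by (intro sum.cong refl) (simp add: assms[of y x for x y] algebra_simps)
  also have "\<dots> = - (\<Sum>x\<in>S. \<Sum>y\<in>S. W x y * a x * (v y - v x))"
    by (simp add: sum_negf)
  moreover have "(\<Sum>x\<in>S. \<Sum>y\<in>S. W x y * (a y - a x) * (v y - v x))
     = (\<Sum>x\<in>S. \<Sum>y\<in>S. W x y * a y * (v y - v x)) - (\<Sum>x\<in>S. \<Sum>y\<in>S. W x y * a x * (v y - v x))"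
    by (simp add: left_diff_distrib right_diff_distrib sum_subtractf)
  ultimately show ?thesis
    by simp
qed

text \<open>The left side is the time derivative of the \<open>L\<^sup>2\<close> energy of a solution \<open>v\<close> with \<open>\<partial>\<^sub>t v = g = \<Delta> v\<close>, localized
  by \<open>\<psi>\<^sup>2\<close>. Summation by parts produces the negative Dirichlet energy and a commutator with \<open>\<psi>\<close>, which
  Young's inequality splits into half of the Dirichlet energy and a term that lives where \<open>\<psi>\<close>
  varies; there the larger cutoff \<open>\<eta>\<close> dominates \<open>(\<psi> y - \<psi> x)\<^sup>2\<close>. The hypothesis
  \<open>g\<close> reflects that the finite set \<open>S\<close> contains all neighbours of the support of \<open>\<psi>\<close>, so that no
  boundary terms arise.\<close>

lemma localized_energy_ineq:
  fixes W :: "'a \<Rightarrow> 'a \<Rightarrow> real"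
  assumes W: "\<And>x y. W x y = W y x" "\<And>x y. W x y \<ge> 0"
    and deg: "\<And>x. x \<in> S \<Longrightarrow> (\<Sum>y\<in>S. W x y) \<le> \<mu> x"
    and g: "\<And>x. x \<in> S \<Longrightarrow> \<psi> x \<noteq> 0 \<Longrightarrow> \<mu> x * g x = (\<Sum>y\<in>S. W x y * (v y - v x))"
    and cut: "\<And>x y. x \<in> S \<Longrightarrow> W x y \<noteq> 0 \<Longrightarrow> (\<psi> y - \<psi> x)\<^sup>2 \<le> \<epsilon> * \<eta> x"
    and "\<epsilon> \<ge> 0" "\<And>x. \<eta> x \<ge> (0::real)"
  shows "2 * (\<Sum>x\<in>S. \<mu> x * (\<psi> x)\<^sup>2 * (v x * g x))
    \<le> - (1/2) * (\<Sum>x\<in>S. \<Sum>y\<in>S. W x y * (\<psi> x)\<^sup>2 * (v y - v x)\<^sup>2)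
      + 2 * \<epsilon> * (\<Sum>x\<in>S. \<mu> x * \<eta> x * (v x)\<^sup>2)"
proof -
  have pointwise: "- ((v y * (\<psi> y)\<^sup>2 - v x * (\<psi> x)\<^sup>2) * (v y - v x))
      \<le> - (1/4) * ((\<psi> x)\<^sup>2 + (\<psi> y)\<^sup>2) * (v y - v x)\<^sup>2 + ((v x)\<^sup>2 + (v y)\<^sup>2) * (\<psi> y - \<psi> x)\<^sup>2" for x y
  proof -
    define p q d s where "p = \<psi> x" "q = \<psi> y" "d = v y - v x" "s = v x + v y"
    (* Young's inequality, written as a sum of squares. *)
    have "0 \<le> (d * (q + p) + 2 * s * (q - p))\<^sup>2 / 8 + (d * (q - p))\<^sup>2 / 8"
      by simp
    also have "\<dots> = (d\<^sup>2 * (p\<^sup>2 + q\<^sup>2)) / 4 + d * s * (q\<^sup>2 - p\<^sup>2) / 2 + s\<^sup>2 * (q - p)\<^sup>2 / 2"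
      by (simp add: power2_eq_square field_simps)
    also have "s\<^sup>2 / 2 = (v x)\<^sup>2 + (v y)\<^sup>2 - d\<^sup>2 / 2"
      by (simp add: p_q_d_s_def power2_eq_square field_simps)
    then have "s\<^sup>2 * (q - p)\<^sup>2 / 2 \<le> ((v x)\<^sup>2 + (v y)\<^sup>2) * (q - p)\<^sup>2"
      by (simp add: mult_right_mono flip: times_divide_eq_left)
    finally have "0 \<le> (d\<^sup>2 * (p\<^sup>2 + q\<^sup>2)) / 4 + d * s * (q\<^sup>2 - p\<^sup>2) / 2
        + ((v x)\<^sup>2 + (v y)\<^sup>2) * (q - p)\<^sup>2" by simp
    moreover have "- ((v y * q\<^sup>2 - v x * p\<^sup>2) * d) = - (d\<^sup>2 * (p\<^sup>2 + q\<^sup>2)) / 2 - d * s * (q\<^sup>2 - p\<^sup>2) / 2"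
      by (simp add: p_q_d_s_def power2_eq_square field_simps)
    moreover have "- (1/4) * (p\<^sup>2 + q\<^sup>2) * d\<^sup>2 = - (d\<^sup>2 * (p\<^sup>2 + q\<^sup>2)) / 4"
      by simp
    ultimately show ?thesis
      unfolding p_q_d_s_def[symmetric] by linarith
  qed
  have sym: "(\<Sum>x\<in>S. \<Sum>y\<in>S. W x y * h y * e x y) = (\<Sum>x\<in>S. \<Sum>y\<in>S. W x y * h x * e x y)"
    if "\<And>x y. e x y = e y x" for h :: "'a \<Rightarrow> real" and e
    by (rule sum_sum_swap) (subst W(1), subst that, rule refl)
  have "2 * (\<Sum>x\<in>S. \<mu> x * (\<psi> x)\<^sup>2 * (v x * g x))
      = 2 * (\<Sum>x\<in>S. (v x * (\<psi> x)\<^sup>2) * (\<Sum>y\<in>S. W x y * (v y - v x)))"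
  proof (intro arg_cong[where f = "(*) 2"] sum.cong refl)
    fix x assume "x \<in> S"
    with g[of x] show "\<mu> x * (\<psi> x)\<^sup>2 * (v x * g x) = v x * (\<psi> x)\<^sup>2 * (\<Sum>y\<in>S. W x y * (v y - v x))"
      by (cases "\<psi> x = 0") (auto simp: algebra_simps simp flip: g)
  qed
  also have "\<dots> = 2 * (\<Sum>x\<in>S. \<Sum>y\<in>S. W x y * (v x * (\<psi> x)\<^sup>2) * (v y - v x))"
    by (simp add: sum_distrib_left algebra_simps)
  also have "\<dots> = (\<Sum>x\<in>S. \<Sum>y\<in>S. W x y * - ((v y * (\<psi> y)\<^sup>2 - v x * (\<psi> x)\<^sup>2) * (v y - v x)))"
    unfolding sum_by_parts[of W, OF W(1)] by (simp add: sum_negf mult.assoc)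
  also have "\<dots> \<le> (\<Sum>x\<in>S. \<Sum>y\<in>S. W x y * (- (1/4) * ((\<psi> x)\<^sup>2 + (\<psi> y)\<^sup>2) * (v y - v x)\<^sup>2
        + ((v x)\<^sup>2 + (v y)\<^sup>2) * (\<psi> y - \<psi> x)\<^sup>2))"
    by (intro sum_mono mult_left_mono pointwise W)
  also have "\<dots> = - (1/4) * ((\<Sum>x\<in>S. \<Sum>y\<in>S. W x y * (\<psi> x)\<^sup>2 * (v y - v x)\<^sup>2)
          + (\<Sum>x\<in>S. \<Sum>y\<in>S. W x y * (\<psi> y)\<^sup>2 * (v y - v x)\<^sup>2))
      + ((\<Sum>x\<in>S. \<Sum>y\<in>S. W x y * (v x)\<^sup>2 * (\<psi> y - \<psi> x)\<^sup>2)
          + (\<Sum>x\<in>S. \<Sum>y\<in>S. W x y * (v y)\<^sup>2 * (\<psi> y - \<psi> x)\<^sup>2))"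
    by (simp add: sum_distrib_left sum.distrib sum_subtractf sum_negf algebra_simps)
  also have "\<dots> = - (1/2) * (\<Sum>x\<in>S. \<Sum>y\<in>S. W x y * (\<psi> x)\<^sup>2 * (v y - v x)\<^sup>2)
      + 2 * (\<Sum>x\<in>S. \<Sum>y\<in>S. W x y * (v x)\<^sup>2 * (\<psi> y - \<psi> x)\<^sup>2)"
    by (subst (1 2) sym) (auto simp: power2_commute)
  also have "(\<Sum>x\<in>S. \<Sum>y\<in>S. W x y * (v x)\<^sup>2 * (\<psi> y - \<psi> x)\<^sup>2) \<le> (\<Sum>x\<in>S. \<epsilon> * (\<mu> x * \<eta> x * (v x)\<^sup>2))"
  proof (rule sum_mono)
    fix x assume x: "x \<in> S"
    have "(\<Sum>y\<in>S. W x y * (v x)\<^sup>2 * (\<psi> y - \<psi> x)\<^sup>2) \<le> (\<Sum>y\<in>S. W x y * (v x)\<^sup>2 * (\<epsilon> * \<eta> x))"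
    proof (rule sum_mono)
      fix y show "W x y * (v x)\<^sup>2 * (\<psi> y - \<psi> x)\<^sup>2 \<le> W x y * (v x)\<^sup>2 * (\<epsilon> * \<eta> x)"
        using cut[OF x, of y] W(2)[of x y] by (cases "W x y = 0") (auto intro!: mult_left_mono)
    qed
    also have "\<dots> = (\<Sum>y\<in>S. W x y) * ((v x)\<^sup>2 * (\<epsilon> * \<eta> x))"
      by (simp add: sum_distrib_right mult.assoc)
    also have "\<dots> \<le> \<mu> x * ((v x)\<^sup>2 * (\<epsilon> * \<eta> x))"
      using deg[OF x] assms(6,7) by (intro mult_right_mono) auto
    finally show "(\<Sum>y\<in>S. W x y * (v x)\<^sup>2 * (\<psi> y - \<psi> x)\<^sup>2) \<le> \<epsilon> * (\<mu> x * \<eta> x * (v x)\<^sup>2)"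
      by (simp add: algebra_simps)
  qed
  finally show ?thesis
    by (simp add: sum_distrib_left mult.assoc)
qed

text \<open>The same estimate one derivative higher: the left side is the time derivative of the localized
  Dirichlet energy. In the commutator the value \<open>\<psi> y\<close> occurs next to \<open>g x\<close>; replacing it by \<open>\<psi> x\<close>
  leaves a term \<open>(g x)\<^sup>2 * (\<psi> y - \<psi> x)\<^sup>2\<close> that has no counterpart in the continuous setting. The
  hypothesis \<open>g2\<close>, a local bound of \<open>g\<close> by the gradient of \<open>v\<close>, turns it into Dirichlet energy.\<close>

lemma localized_gradient_ineq:
  fixes W :: "'a \<Rightarrow> 'a \<Rightarrow> real"
  assumes W: "\<And>x y. W x y = W y x" "\<And>x y. W x y \<ge> 0"
    and deg: "\<And>x. x \<in> S \<Longrightarrow> (\<Sum>y\<in>S. W x y) \<le> \<mu> x"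
    and g: "\<And>x. x \<in> S \<Longrightarrow> \<psi> x \<noteq> 0 \<Longrightarrow> \<mu> x * g x = (\<Sum>y\<in>S. W x y * (v y - v x))"
    and cut: "\<And>x y. x \<in> S \<Longrightarrow> W x y \<noteq> 0 \<Longrightarrow> (\<psi> y - \<psi> x)\<^sup>2 \<le> \<epsilon> * \<eta> x"
    and "\<epsilon> \<ge> 0" "\<And>x. \<eta> x \<ge> (0::real)"
    and g2: "\<And>x. x \<in> S \<Longrightarrow> \<eta> x \<noteq> 0 \<Longrightarrow> \<mu> x * (g x)\<^sup>2 \<le> (\<Sum>y\<in>S. W x y * (v y - v x)\<^sup>2)"
  shows "2 * (\<Sum>x\<in>S. \<Sum>y\<in>S. W x y * (\<psi> x)\<^sup>2 * ((v y - v x) * (g y - g x)))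
    \<le> - (1/2) * (\<Sum>x\<in>S. \<mu> x * (\<psi> x)\<^sup>2 * (g x)\<^sup>2)
      + 4 * \<epsilon> * (\<Sum>x\<in>S. \<Sum>y\<in>S. W x y * \<eta> x * (v y - v x)\<^sup>2)"
proof -
  have young: "- (2 * (g x * ((\<psi> y)\<^sup>2 - (\<psi> x)\<^sup>2) * (v y - v x)))
      \<le> 2 * (g x)\<^sup>2 * (\<psi> x)\<^sup>2 + 3 * (v y - v x)\<^sup>2 * (\<psi> y - \<psi> x)\<^sup>2 + (g x)\<^sup>2 * (\<psi> y - \<psi> x)\<^sup>2" for x y
  proof -
    define p e d s where "p = \<psi> x" "e = \<psi> y - \<psi> x" "d = v y - v x" "s = g x"
    have "0 \<le> 2 * (s * p + d * e)\<^sup>2 + (s + d)\<^sup>2 * e\<^sup>2"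
      by simp
    also have "\<dots> = 2 * s\<^sup>2 * p\<^sup>2 + 3 * d\<^sup>2 * e\<^sup>2 + s\<^sup>2 * e\<^sup>2 + 2 * (s * (2 * p * e + e\<^sup>2) * d)"
      by (simp add: power2_eq_square algebra_simps)
    also have "2 * p * e + e\<^sup>2 = (\<psi> y)\<^sup>2 - (\<psi> x)\<^sup>2"
      by (simp add: p_e_d_s_def power2_eq_square algebra_simps)
    finally show ?thesis
      by (simp add: p_e_d_s_def)
  qed
  have "2 * (\<Sum>x\<in>S. \<Sum>y\<in>S. W x y * (\<psi> x)\<^sup>2 * ((v y - v x) * (g y - g x)))
      = (\<Sum>x\<in>S. \<Sum>y\<in>S. (W x y * ((\<psi> x)\<^sup>2 + (\<psi> y)\<^sup>2)) * (g y - g x) * (v y - v x))"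
  proof -
    have "(\<Sum>x\<in>S. \<Sum>y\<in>S. W x y * (\<psi> x)\<^sup>2 * ((v y - v x) * (g y - g x)))
        = (\<Sum>x\<in>S. \<Sum>y\<in>S. W x y * (\<psi> y)\<^sup>2 * ((v y - v x) * (g y - g x)))"
      by (rule sum_sum_swap) (subst W(1), simp add: algebra_simps)
    moreover have "(\<Sum>x\<in>S. \<Sum>y\<in>S. (W x y * ((\<psi> x)\<^sup>2 + (\<psi> y)\<^sup>2)) * (g y - g x) * (v y - v x))
        = (\<Sum>x\<in>S. \<Sum>y\<in>S. W x y * (\<psi> x)\<^sup>2 * ((v y - v x) * (g y - g x)))
        + (\<Sum>x\<in>S. \<Sum>y\<in>S. W x y * (\<psi> y)\<^sup>2 * ((v y - v x) * (g y - g x)))"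
      by (simp only: sum.distrib[symmetric]) (intro sum.cong refl, simp add: algebra_simps)
    ultimately show ?thesis
      by simp
  qed
  also have "\<dots> = - 2 * (\<Sum>x\<in>S. \<Sum>y\<in>S. (W x y * ((\<psi> x)\<^sup>2 + (\<psi> y)\<^sup>2)) * g x * (v y - v x))"
    by (subst sum_by_parts) (auto simp: W(1) add.commute)
  also have "\<dots> = (\<Sum>x\<in>S. - 4 * ((\<psi> x)\<^sup>2 * g x * (\<Sum>y\<in>S. W x y * (v y - v x)))
      + (\<Sum>y\<in>S. W x y * - (2 * (g x * ((\<psi> y)\<^sup>2 - (\<psi> x)\<^sup>2) * (v y - v x)))))"
    by (simp only: sum_distrib_left sum.distrib[symmetric])
      (intro sum.cong refl, simp add: algebra_simps)
  also have "\<dots> \<le> (\<Sum>x\<in>S. - 4 * (\<mu> x * (\<psi> x)\<^sup>2 * (g x)\<^sup>2)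
      + (2 * (\<mu> x * (\<psi> x)\<^sup>2 * (g x)\<^sup>2) + 4 * \<epsilon> * (\<Sum>y\<in>S. W x y * \<eta> x * (v y - v x)\<^sup>2)))"
  proof (rule sum_mono, rule add_mono)
    fix x assume x: "x \<in> S"
    show "- 4 * ((\<psi> x)\<^sup>2 * g x * (\<Sum>y\<in>S. W x y * (v y - v x))) \<le> - 4 * (\<mu> x * (\<psi> x)\<^sup>2 * (g x)\<^sup>2)"
    proof (cases "\<psi> x = 0")
      case False
      then show ?thesis
        unfolding g[OF x False, symmetric] by (simp add: power2_eq_square algebra_simps)
    qed simp
    let ?G = "\<Sum>y\<in>S. W x y * (v y - v x)\<^sup>2"
    have "(\<Sum>y\<in>S. W x y * - (2 * (g x * ((\<psi> y)\<^sup>2 - (\<psi> x)\<^sup>2) * (v y - v x))))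
        \<le> (\<Sum>y\<in>S. W x y * (2 * (g x)\<^sup>2 * (\<psi> x)\<^sup>2 + 3 * (v y - v x)\<^sup>2 * (\<epsilon> * \<eta> x) + (g x)\<^sup>2 * (\<epsilon> * \<eta> x)))"
    proof (rule sum_mono)
      fix y
      show "W x y * - (2 * (g x * ((\<psi> y)\<^sup>2 - (\<psi> x)\<^sup>2) * (v y - v x)))
        \<le> W x y * (2 * (g x)\<^sup>2 * (\<psi> x)\<^sup>2 + 3 * (v y - v x)\<^sup>2 * (\<epsilon> * \<eta> x) + (g x)\<^sup>2 * (\<epsilon> * \<eta> x))"
      proof (cases "W x y = 0")
        case False
        have "3 * (v y - v x)\<^sup>2 * (\<psi> y - \<psi> x)\<^sup>2 \<le> 3 * (v y - v x)\<^sup>2 * (\<epsilon> * \<eta> x)"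
          "(g x)\<^sup>2 * (\<psi> y - \<psi> x)\<^sup>2 \<le> (g x)\<^sup>2 * (\<epsilon> * \<eta> x)"
          using cut[OF x False] by (auto intro: mult_left_mono)
        then show ?thesis
          using young[of x y] by (intro mult_left_mono W) linarith
      qed simp
    qed
    also have "\<dots> = (\<Sum>y\<in>S. W x y) * (2 * (g x)\<^sup>2 * (\<psi> x)\<^sup>2 + (g x)\<^sup>2 * (\<epsilon> * \<eta> x)) + 3 * (\<epsilon> * \<eta> x) * ?G"
      by (simp add: sum_distrib_left sum_distrib_right sum.distrib algebra_simps)
    also have "\<dots> \<le> \<mu> x * (2 * (g x)\<^sup>2 * (\<psi> x)\<^sup>2 + (g x)\<^sup>2 * (\<epsilon> * \<eta> x)) + 3 * (\<epsilon> * \<eta> x) * ?G"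
      using deg[OF x] assms(6,7) by (intro add_right_mono mult_right_mono) auto
    also have "\<dots> = 2 * (\<mu> x * (\<psi> x)\<^sup>2 * (g x)\<^sup>2) + \<epsilon> * \<eta> x * (\<mu> x * (g x)\<^sup>2) + 3 * (\<epsilon> * \<eta> x) * ?G"
      by (simp add: algebra_simps)
    also have "\<dots> \<le> 2 * (\<mu> x * (\<psi> x)\<^sup>2 * (g x)\<^sup>2) + \<epsilon> * \<eta> x * ?G + 3 * (\<epsilon> * \<eta> x) * ?G"
    proof -
      have "\<epsilon> * \<eta> x * (\<mu> x * (g x)\<^sup>2) \<le> \<epsilon> * \<eta> x * ?G"
      proof (cases "\<eta> x = 0")
        case False
        show ?thesis
          using g2[OF x False] assms(6,7) by (intro mult_left_mono) auto
      qed simp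
      then show ?thesis by linarith
    qed
    also have "\<dots> = 2 * (\<mu> x * (\<psi> x)\<^sup>2 * (g x)\<^sup>2) + 4 * \<epsilon> * (\<eta> x * ?G)"
      by simp
    also have G: "\<eta> x * ?G = (\<Sum>y\<in>S. W x y * \<eta> x * (v y - v x)\<^sup>2)"
      by (simp add: sum_distrib_left algebra_simps)
    finally show "(\<Sum>y\<in>S. W x y * - (2 * (g x * ((\<psi> y)\<^sup>2 - (\<psi> x)\<^sup>2) * (v y - v x))))
       \<le> 2 * (\<mu> x * (\<psi> x)\<^sup>2 * (g x)\<^sup>2) + 4 * \<epsilon> * (\<Sum>y\<in>S. W x y * \<eta> x * (v y - v x)\<^sup>2)"
      .
  qed
  also have "\<dots> = - 2 * (\<Sum>x\<in>S. \<mu> x * (\<psi> x)\<^sup>2 * (g x)\<^sup>2)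
      + 4 * \<epsilon> * (\<Sum>x\<in>S. \<Sum>y\<in>S. W x y * \<eta> x * (v y - v x)\<^sup>2)"
    by (simp add: sum.distrib sum_distrib_left sum_negf sum_subtractf mult.assoc)
  also have "\<dots> \<le> - (1/2) * (\<Sum>x\<in>S. \<mu> x * (\<psi> x)\<^sup>2 * (g x)\<^sup>2)
      + 4 * \<epsilon> * (\<Sum>x\<in>S. \<Sum>y\<in>S. W x y * \<eta> x * (v y - v x)\<^sup>2)"
  proof -
    have "\<mu> x \<ge> 0" if "x \<in> S" for x
      using deg[OF that] sum_nonneg[of S "W x"] W(2) by fastforce
    then have "(\<Sum>x\<in>S. \<mu> x * (\<psi> x)\<^sup>2 * (g x)\<^sup>2) \<ge> 0"
      by (intro sum_nonneg) auto
    then show ?thesis by simp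
  qed
  finally show ?thesis .
qed

section \<open>Localized energies of an ancient solution\<close>

context weighted_graph
begin

abbreviation lap_pow :: "nat \<Rightarrow> ('v \<Rightarrow> real) \<Rightarrow> 'v \<Rightarrow> real" where
  "lap_pow n \<equiv> laplacian E w ^^ n"

lemma lap_pow_deriv:
  assumes "ancient_solution E w u" "t \<le> 0"
  shows "((\<lambda>s. lap_pow n (\<lambda>y. u y s) x) has_real_derivative lap_pow (Suc n) (\<lambda>y. u y t) x) (at t within {..0})"
proof (induction n arbitrary: x)
  case 0
  then show ?case
    using assms by (simp add: ancient_solution_def)
next
  case (Suc n)
  have *: "lap_pow (Suc m) f x = (\<Sum>y | adj E x y. w {x, y} / vdeg E w x * (lap_pow m f y - lap_pow m f x))" for m f
    by (simp add: laplacian_def)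
  have fun_eq: "(\<lambda>s. lap_pow (Suc n) (\<lambda>y. u y s) x) = (\<lambda>s. \<Sum>y | adj E x y.
      w {x, y} / vdeg E w x * (lap_pow n (\<lambda>y. u y s) y - lap_pow n (\<lambda>y. u y s) x))"
    by (intro ext *)
  show ?case
    by (subst fun_eq, subst *[of "Suc n"]) (intro DERIV_sum DERIV_cmult DERIV_diff Suc)
qed

text \<open>Even indices \<open>2 * i\<close> give the weighted \<open>L\<^sup>2\<close> norm of \<open>\<Delta> ^ i f\<close>, odd indices \<open>2 * i + 1\<close> its weighted
  Dirichlet energy: the squared norm of the derivative of order \<open>j\<close>.\<close>

definition energy :: "nat \<Rightarrow> 'v set \<Rightarrow> ('v \<Rightarrow> real) \<Rightarrow> ('v \<Rightarrow> real) \<Rightarrow> real" where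
  "energy j S \<eta> f = (let v = lap_pow (j div 2) f in
     if even j then \<Sum>x\<in>S. vdeg E w x * \<eta> x * (v x)\<^sup>2
     else \<Sum>x\<in>S. \<Sum>y\<in>S. wt x y * \<eta> x * (v y - v x)\<^sup>2)"

lemma energy_nonneg: "(\<And>x. \<eta> x \<ge> 0) \<Longrightarrow> energy j S \<eta> f \<ge> 0"
  by (auto simp: energy_def Let_def intro!: sum_nonneg mult_nonneg_nonneg vdeg_nonneg wt_nonneg)

lemma energy_mono: "(\<And>x. \<eta> x \<le> \<eta>' x) \<Longrightarrow> energy j S \<eta> f \<le> energy j S \<eta>' f"
  by (auto simp: energy_def Let_def intro!: sum_mono mult_right_mono mult_left_mono vdeg_nonneg wt_nonneg)

text \<open>Along a solution the energies form a ladder: each one decreases at a rate given by the next one,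
  up to a multiple of itself with the larger cutoff. The two parities are
  \<open>localized_energy_ineq\<close> and \<open>localized_gradient_ineq\<close>, weakened to common constants.\<close>

lemma energy_deriv:
  assumes u: "ancient_solution E w u" "t \<le> 0"
    and S: "finite S" "\<And>x. x \<in> S \<Longrightarrow> \<psi> x \<noteq> 0 \<or> \<eta> x \<noteq> 0 \<Longrightarrow> {y. adj E x y} \<subseteq> S"
    and cut: "\<And>x y. adj E x y \<Longrightarrow> (\<psi> y - \<psi> x)\<^sup>2 \<le> \<epsilon> * \<eta> x"
    and "\<epsilon> \<ge> 0" "\<And>x. \<eta> x \<ge> 0"
  shows "\<exists>D. ((\<lambda>s. energy j S (\<lambda>x. (\<psi> x)\<^sup>2) (\<lambda>y. u y s)) has_real_derivative D) (at t within {..0}) \<and>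
    D \<le> - (1/2) * energy (Suc j) S (\<lambda>x. (\<psi> x)\<^sup>2) (\<lambda>y. u y t) + 4 * \<epsilon> * energy j S \<eta> (\<lambda>y. u y t)"
proof -
  define n where "n = j div 2"
  define v where "v = lap_pow n (\<lambda>y. u y t)"
  define g where "g = laplacian E w v"
  have g_eq: "lap_pow (Suc n) (\<lambda>y. u y t) = g"
    by (simp add: g_def v_def)
  note d = lap_pow_deriv[OF u, of n, unfolded g_eq]
  have deg: "(\<Sum>y\<in>S. wt x y) \<le> vdeg E w x" for x
    by (rule sum_wt_le_vdeg[OF S(1)])
  have gx: "vdeg E w x * g x = (\<Sum>y\<in>S. wt x y * (v y - v x))" if "x \<in> S" "\<psi> x \<noteq> 0" for x
    unfolding g_def using that by (intro vdeg_laplacian S) auto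
  have g2: "vdeg E w x * (g x)\<^sup>2 \<le> (\<Sum>y\<in>S. wt x y * (v y - v x)\<^sup>2)" if "x \<in> S" "\<eta> x \<noteq> 0" for x
    unfolding g_def using that by (intro laplacian_square_le S) auto
  have cut': "(\<psi> y - \<psi> x)\<^sup>2 \<le> \<epsilon> * \<eta> x" if "wt x y \<noteq> 0" for x y
    using that cut by (auto simp: wt_def split: if_splits)
  show ?thesis
  proof (cases "even j")
    case True
    then have j: "Suc j div 2 = n"
      by (simp add: n_def)
    have "((\<lambda>s. energy j S (\<lambda>x. (\<psi> x)\<^sup>2) (\<lambda>y. u y s)) has_real_derivative
        (\<Sum>x\<in>S. vdeg E w x * (\<psi> x)\<^sup>2 * (2 * (v x * g x)))) (at t within {..0})"
      unfolding energy_def Let_def n_def[symmetric] if_P[OF True]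
      by (rule derivative_eq_intros d refl)+ (simp add: algebra_simps flip: v_def)
    moreover have "(\<Sum>x\<in>S. vdeg E w x * (\<psi> x)\<^sup>2 * (2 * (v x * g x)))
        \<le> - (1/2) * energy (Suc j) S (\<lambda>x. (\<psi> x)\<^sup>2) (\<lambda>y. u y t) + 4 * \<epsilon> * energy j S \<eta> (\<lambda>y. u y t)"
    proof -
      have "2 * (\<Sum>x\<in>S. vdeg E w x * (\<psi> x)\<^sup>2 * (v x * g x))
        \<le> - (1/2) * (\<Sum>x\<in>S. \<Sum>y\<in>S. wt x y * (\<psi> x)\<^sup>2 * (v y - v x)\<^sup>2)
          + 2 * \<epsilon> * (\<Sum>x\<in>S. vdeg E w x * \<eta> x * (v x)\<^sup>2)"
        by (rule localized_energy_ineq) (use wt_commute wt_nonneg deg gx cut' assms in auto)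
      moreover have "energy (Suc j) S (\<lambda>x. (\<psi> x)\<^sup>2) (\<lambda>y. u y t) = (\<Sum>x\<in>S. \<Sum>y\<in>S. wt x y * (\<psi> x)\<^sup>2 * (v y - v x)\<^sup>2)"
        using True by (simp add: energy_def Let_def j v_def)
      moreover have e: "energy j S \<eta> (\<lambda>y. u y t) = (\<Sum>x\<in>S. vdeg E w x * \<eta> x * (v x)\<^sup>2)"
        using True by (simp add: energy_def Let_def v_def n_def)
      moreover have "\<epsilon> * energy j S \<eta> (\<lambda>y. u y t) \<ge> 0"
        using assms by (simp add: energy_nonneg)
      moreover have "(\<Sum>x\<in>S. vdeg E w x * (\<psi> x)\<^sup>2 * (2 * (v x * g x)))
          = 2 * (\<Sum>x\<in>S. vdeg E w x * (\<psi> x)\<^sup>2 * (v x * g x))"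
        unfolding sum_distrib_left by (intro sum.cong) auto
      ultimately show ?thesis by simp
    qed
    ultimately show ?thesis
      by blast
  next
    case False
    then have j: "Suc j div 2 = Suc n"
      by (simp add: n_def)
    have "((\<lambda>s. energy j S (\<lambda>x. (\<psi> x)\<^sup>2) (\<lambda>y. u y s)) has_real_derivative
        (\<Sum>x\<in>S. \<Sum>y\<in>S. wt x y * (\<psi> x)\<^sup>2 * (2 * ((v y - v x) * (g y - g x))))) (at t within {..0})"
      unfolding energy_def Let_def n_def[symmetric] if_not_P[OF False]
      by (rule derivative_eq_intros d refl)+ (simp add: algebra_simps flip: v_def)
    moreover have "(\<Sum>x\<in>S. \<Sum>y\<in>S. wt x y * (\<psi> x)\<^sup>2 * (2 * ((v y - v x) * (g y - g x))))
        \<le> - (1/2) * energy (Suc j) S (\<lambda>x. (\<psi> x)\<^sup>2) (\<lambda>y. u y t) + 4 * \<epsilon> * energy j S \<eta> (\<lambda>y. u y t)"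
    proof -
      have "2 * (\<Sum>x\<in>S. \<Sum>y\<in>S. wt x y * (\<psi> x)\<^sup>2 * ((v y - v x) * (g y - g x)))
        \<le> - (1/2) * (\<Sum>x\<in>S. vdeg E w x * (\<psi> x)\<^sup>2 * (g x)\<^sup>2)
          + 4 * \<epsilon> * (\<Sum>x\<in>S. \<Sum>y\<in>S. wt x y * \<eta> x * (v y - v x)\<^sup>2)"
        by (rule localized_gradient_ineq) (use wt_commute wt_nonneg deg gx cut' g2 assms in auto)
      moreover have "energy (Suc j) S (\<lambda>x. (\<psi> x)\<^sup>2) (\<lambda>y. u y t) = (\<Sum>x\<in>S. vdeg E w x * (\<psi> x)\<^sup>2 * (g x)\<^sup>2)"
        using False g_eq by (simp add: energy_def Let_def j)
      moreover have "energy j S \<eta> (\<lambda>y. u y t) = (\<Sum>x\<in>S. \<Sum>y\<in>S. wt x y * \<eta> x * (v y - v x)\<^sup>2)"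
        using False by (simp add: energy_def Let_def v_def n_def)
      moreover have "(\<Sum>x\<in>S. \<Sum>y\<in>S. wt x y * (\<psi> x)\<^sup>2 * (2 * ((v y - v x) * (g y - g x))))
          = 2 * (\<Sum>x\<in>S. \<Sum>y\<in>S. wt x y * (\<psi> x)\<^sup>2 * ((v y - v x) * (g y - g x)))"
        unfolding sum_distrib_left by (intro sum.cong) auto
      ultimately show ?thesis by simp
    qed
    ultimately show ?thesis
      by blast
  qed
qed

section \<open>Cutoff functions and the combined functional\<close>

text \<open>One on the ball of radius \<open>(c - 1) * R\<close> about \<open>p\<close>, zero outside the ball of radius \<open>c * R\<close>, linear in
  the distance between them.\<close>

definition cutoff :: "'v \<Rightarrow> real \<Rightarrow> real \<Rightarrow> 'v \<Rightarrow> real" where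
  "cutoff p R c x = max 0 (min 1 (c - real (gdist E x p) / R))"

lemma cutoff_bounds: "0 \<le> cutoff p R c x" "cutoff p R c x \<le> 1"
  by (auto simp: cutoff_def)

lemma cutoff_mono: "c \<le> c' \<Longrightarrow> cutoff p R c x \<le> cutoff p R c' x"
  by (auto simp: cutoff_def)

text \<open>Where the cutoff varies along an edge, one end of the edge is at distance at most \<open>c * R\<close>, so both
  are at distance at most \<open>(c + 1) * R\<close> since \<open>R \<ge> 1\<close>, and the cutoff with parameter \<open>c + 2\<close> equals one.\<close>

lemma cutoff_diff_le:
  assumes "adj E x y" "R \<ge> 1"
  shows "(cutoff p R c y - cutoff p R c x)\<^sup>2 \<le> 1 / R\<^sup>2 * (cutoff p R (c + 2) x)\<^sup>2"
proof -
  define a b where "a = real (gdist E x p) / R" and "b = real (gdist E y p) / R"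
  have "real (gdist E x p) \<le> real (gdist E y p) + 1" "real (gdist E y p) \<le> real (gdist E x p) + 1"
    using gdist_adj[of x y p] gdist_adj[of y x p] assms(1) adj_commute[of x y] by auto
  then have ab: "a \<le> b + 1 / R" "b \<le> a + 1 / R"
    using assms(2) by (auto simp: a_def b_def field_simps)
  have R: "1 / R \<le> 1"
    using assms(2) by simp
  show ?thesis
  proof (cases "a \<le> c + 1")
    case True
    then have "cutoff p R (c + 2) x = 1"
      by (simp add: cutoff_def a_def)
    moreover have "\<bar>cutoff p R c y - cutoff p R c x\<bar> \<le> 1 / R"
    proof -
      have "\<bar>max 0 (min 1 (c - b)) - max 0 (min 1 (c - a))\<bar> \<le> r"
        if "a \<le> b + r" "b \<le> a + r" "r \<ge> 0" for r
        using that by (auto simp: max_def min_def)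
      from this[OF ab] show ?thesis
        using assms(2) unfolding cutoff_def a_def[symmetric] b_def[symmetric] by simp
    qed
    ultimately show ?thesis
      using power_mono[of "\<bar>cutoff p R c y - cutoff p R c x\<bar>" "1 / R" 2] by (simp add: power_divide)
  next
    case False
    then have "cutoff p R c y = 0" "cutoff p R c x = 0"
      using ab R unfolding cutoff_def a_def[symmetric] b_def[symmetric] by auto
    then show ?thesis
      by simp
  qed
qed

lemma cutoff_support:
  assumes "cutoff p R c x \<noteq> 0" "R \<ge> 1"
  shows "real (gdist E x p) \<le> c * R"
proof (rule ccontr)
  assume "\<not> ?thesis"
  then have "real (gdist E x p) / R > c"
    using assms(2) by (simp add: field_simps)
  then show False
    using assms(1) by (simp add: cutoff_def)
qed

text \<open>The coefficients of the combined functional. Their ratio is chosen such that, in the proof of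
  \<open>functional_deriv\<close>, the error of level \<open>n + 1\<close>, namely \<open>coef (Suc n) * (n + 5)\<close> times an energy, is exactly
  the gain \<open>coef n / 2\<close> of level \<open>n\<close>.\<close>

definition coef :: "nat \<Rightarrow> real" where
  "coef n = (\<Prod>i<n. 1 / (2 * (real i + 5)))"

lemma coef_simps: "coef 0 = 1" "coef (Suc n) = coef n / (2 * (real n + 5))" "coef n > 0"
  by (auto simp: coef_def intro!: prod_pos)

text \<open>The functional sums the energies with powers of the elapsed time \<open>\<tau> - a \<le> R\<^sup>2\<close>, so that all terms
  have the scaling of the zeroth one. Differentiating the power and the error term of
  \<open>energy_deriv\<close> both cost \<open>(t - a) ^ n\<close> times the energy of level \<open>n + 1\<close>, which the gain of level
  \<open>n\<close> absorbs; this needs the cutoffs to shrink as the level grows. The errors thus telescope, and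
  only that of level zero remains.\<close>

lemma functional_deriv:
  assumes u: "ancient_solution E w u" "t \<le> 0"
    and R: "R \<ge> 1" and S: "S = gball E p ((c + 1) * R)"
    and \<psi>: "\<And>j x. \<psi> j x = (cutoff p R (c - 2 * real j) x)\<^sup>2"
    and s: "0 \<le> t - a" "t - a \<le> R\<^sup>2"
  shows "\<exists>D. ((\<lambda>\<tau>. \<Sum>j\<le>n. coef j * (\<tau> - a) ^ j * energy j S (\<psi> (Suc j)) (\<lambda>y. u y \<tau>))
        has_real_derivative D) (at t within {..0}) \<and>
      D \<le> 4 / R\<^sup>2 * energy 0 S (\<psi> 0) (\<lambda>y. u y t)
          - (1/2) * (coef n * (t - a) ^ n) * energy (Suc n) S (\<psi> (Suc n)) (\<lambda>y. u y t)"
proof -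
  have step: "\<exists>D. ((\<lambda>\<tau>. energy j S (\<psi> (Suc j)) (\<lambda>y. u y \<tau>)) has_real_derivative D) (at t within {..0}) \<and>
      D \<le> - (1/2) * energy (Suc j) S (\<psi> (Suc j)) (\<lambda>y. u y t) + 4 * (1 / R\<^sup>2) * energy j S (\<psi> j) (\<lambda>y. u y t)" for j
  proof -
    have nb: "{y. adj E x y} \<subseteq> S" if "cutoff p R (c - 2 * real i) x \<noteq> 0" for x i
    proof
      fix y assume "y \<in> {y. adj E x y}"
      then have "gdist E y p \<le> Suc (gdist E x p)"
        using gdist_adj[of y x p] adj_commute[of x y] by simp
      then have "real (gdist E y p) \<le> real (gdist E x p) + 1"
        by linarith
      moreover have "real (gdist E x p) \<le> (c - 2 * real i) * R"
        using cutoff_support[OF that R] .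
      moreover have "(c - 2 * real i) * R \<le> c * R"
        using R by (intro mult_right_mono) auto
      ultimately show "y \<in> S"
        using R unfolding S gball_def by (simp only: mem_Collect_eq distrib_right[of c 1 R])
    qed
    have \<psi>': "\<psi> (Suc j) = (\<lambda>x. (cutoff p R (c - 2 * real (Suc j)) x)\<^sup>2)"
      using \<psi> by auto
    show ?thesis
      unfolding \<psi>'
    proof (rule energy_deriv[OF u])
      show "finite S"
        by (simp add: S finite_gball)
      show "{y. adj E x y} \<subseteq> S" if "cutoff p R (c - 2 * real (Suc j)) x \<noteq> 0 \<or> \<psi> j x \<noteq> 0" for x
        using that nb[of "Suc j" x] nb[of j x] by (auto simp: \<psi>)
      show "(cutoff p R (c - 2 * real (Suc j)) y - cutoff p R (c - 2 * real (Suc j)) x)\<^sup>2 \<le> 1 / R\<^sup>2 * \<psi> j x"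
        if "adj E x y" for x y
        using cutoff_diff_le[OF that R, of p "c - 2 * real (Suc j)"] by (simp add: \<psi> algebra_simps)
    qed (auto simp: \<psi>)
  qed
  show ?thesis
  proof (induction n)
    case 0
    then show ?case
      using step[of 0] by (simp add: coef_simps)
  next
    case (Suc n)
    let ?E = "\<lambda>j i. energy j S (\<psi> i) (\<lambda>y. u y t)"
    let ?s = "t - a"
    obtain D where D: "((\<lambda>\<tau>. \<Sum>j\<le>n. coef j * (\<tau> - a) ^ j * energy j S (\<psi> (Suc j)) (\<lambda>y. u y \<tau>))
        has_real_derivative D) (at t within {..0})"
      "D \<le> 4 / R\<^sup>2 * ?E 0 0 - (1/2) * (coef n * ?s ^ n) * ?E (Suc n) (Suc n)"
      using Suc by blast
    obtain D' where D': "((\<lambda>\<tau>. energy (Suc n) S (\<psi> (Suc (Suc n))) (\<lambda>y. u y \<tau>)) has_real_derivative D')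
        (at t within {..0})"
      "D' \<le> - (1/2) * ?E (Suc (Suc n)) (Suc (Suc n)) + 4 * (1 / R\<^sup>2) * ?E (Suc n) (Suc n)"
      using step[of "Suc n"] by blast
    define D'' where "D'' = coef (Suc n) * (real (Suc n) * ?s ^ n) * ?E (Suc n) (Suc (Suc n))
        + coef (Suc n) * ?s ^ Suc n * D'"
    have "((\<lambda>\<tau>. coef (Suc n) * (\<tau> - a) ^ Suc n * energy (Suc n) S (\<psi> (Suc (Suc n))) (\<lambda>y. u y \<tau>))
        has_real_derivative D'') (at t within {..0})"
      by (rule derivative_eq_intros D'(1) refl)+ (simp add: D''_def algebra_simps)
    then have "((\<lambda>\<tau>. \<Sum>j\<le>Suc n. coef j * (\<tau> - a) ^ j * energy j S (\<psi> (Suc j)) (\<lambda>y. u y \<tau>))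
        has_real_derivative D + D'') (at t within {..0})"
      unfolding sum.atMost_Suc by (rule DERIV_add[OF D(1)])
    moreover have "D + D'' \<le> 4 / R\<^sup>2 * ?E 0 0
        - (1/2) * (coef (Suc n) * ?s ^ Suc n) * ?E (Suc (Suc n)) (Suc (Suc n))"
    proof -
      define X Y where "X = ?E (Suc n) (Suc n)" and "Y = ?E (Suc (Suc n)) (Suc (Suc n))"
      have X: "X \<ge> 0"
        unfolding X_def by (intro energy_nonneg) (simp add: \<psi>)
      (* The cutoffs are nested, so the energy of level n + 1 may be compared on the larger one. *)
      have EX: "?E (Suc n) (Suc (Suc n)) \<le> X"
        unfolding X_def by (intro energy_mono) (simp add: \<psi> cutoff_bounds cutoff_mono power_mono)
      have cp: "coef (Suc n) > 0"
        by (rule coef_simps)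
      have "coef (Suc n) * ?s ^ Suc n * D' \<le> coef (Suc n) * ?s ^ Suc n * (- (1/2) * Y + 4 * (1 / R\<^sup>2) * X)"
        using D'(2) s(1) cp unfolding X_def Y_def by (intro mult_left_mono mult_nonneg_nonneg) auto
      also have "\<dots> = - (1/2) * (coef (Suc n) * ?s ^ Suc n) * Y + coef (Suc n) * ?s ^ n * X * 4 * (?s / R\<^sup>2)"
        by (simp add: algebra_simps diff_divide_distrib)
      also have "coef (Suc n) * ?s ^ n * X * 4 * (?s / R\<^sup>2) \<le> coef (Suc n) * ?s ^ n * X * 4 * 1"
        using s R cp X by (intro mult_left_mono) auto
      finally have 1: "coef (Suc n) * ?s ^ Suc n * D'
          \<le> - (1/2) * (coef (Suc n) * ?s ^ Suc n) * Y + 4 * (coef (Suc n) * ?s ^ n * X)"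
        by (simp add: algebra_simps)
      have "coef (Suc n) * (real (Suc n) * ?s ^ n) * ?E (Suc n) (Suc (Suc n))
          \<le> coef (Suc n) * (real (Suc n) * ?s ^ n) * X"
        using EX s(1) cp by (intro mult_left_mono) auto
      with 1 have "D'' \<le> - (1/2) * (coef (Suc n) * ?s ^ Suc n) * Y
          + (coef (Suc n) * (real n + 5)) * ?s ^ n * X"
        unfolding D''_def by (simp add: algebra_simps)
      moreover have "coef (Suc n) * (real n + 5) = coef n / 2"
      proof -
        have "real n + 5 \<noteq> 0" by linarith
        then show ?thesis
          unfolding coef_simps by (metis nonzero_mult_div_cancel_right times_divide_eq_left mult_divide_mult_cancel_right)
      qed
      ultimately show ?thesis
        using D(2) unfolding X_def[symmetric] Y_def[symmetric] by simp
    qed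
    ultimately show ?case
      by blast
  qed
qed

end

section \<open>Vanishing of high powers of the Laplacian\<close>

text \<open>A mean value inequality with derivatives relative to \<open>{..0}\<close>, which are one-sided when \<open>b = 0\<close>.\<close>

lemma increment_le_of_deriv_le:
  fixes F :: "real \<Rightarrow> real"
  assumes "a \<le> b" "b \<le> 0"
    and d: "\<And>t. a \<le> t \<Longrightarrow> t \<le> b \<Longrightarrow> \<exists>D. (F has_real_derivative D) (at t within {..0}) \<and> D \<le> L"
  shows "F b \<le> F a + L * (b - a)"
proof -
  have "F a - L * a \<ge> F b - L * b"
  proof (rule DERIV_nonpos_imp_decreasing_open[OF \<open>a \<le> b\<close>, of "\<lambda>t. F t - L * t"])
    fix t assume t: "a < t" "t < b"
    then obtain D where D: "(F has_real_derivative D) (at t within {..0})" "D \<le> L"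
      using d[of t] by auto
    have "at t within {..0} = at t"
      using t assms by (intro at_within_interior) simp
    then have "((\<lambda>t. F t - L * t) has_real_derivative D - L) (at t)"
      using D(1) by (auto intro!: derivative_eq_intros)
    then show "\<exists>y. ((\<lambda>t. F t - L * t) has_real_derivative y) (at t) \<and> y \<le> 0"
      using D(2) by (intro exI[of _ "D - L"]) auto
  next
    have "continuous_on {a..b} F"
      unfolding continuous_on_eq_continuous_within
    proof
      fix t assume t: "t \<in> {a..b}"
      then obtain D where "(F has_real_derivative D) (at t within {..0})"
        using d[of t] by auto
      then have "continuous (at t within {..0}) F"
        by (rule DERIV_continuous)
      then show "continuous (at t within {a..b}) F"
        using assms(2) by (elim continuous_within_subset) auto
    qed
    then show "continuous_on {a..b} (\<lambda>t. F t - L * t)"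
      by (intro continuous_intros)
  qed
  then show ?thesis
    by (simp add: algebra_simps)
qed

context weighted_graph
begin

text \<open>Over a time span \<open>R\<^sup>2\<close>, the bound on the combined functional gives that \<open>R ^ (2 * n)\<close> times
  the energy of level \<open>n = 2 * m\<close> is at most five times the supremum of the energy of level zero. The
  latter grows like \<open>R powr (\<alpha> + 4 * q)\<close>, an exponent that does not depend on \<open>m\<close>; so for large \<open>m\<close>
  the limit \<open>R \<rightarrow> \<infinity>\<close> forces \<open>\<Delta> ^ m u\<close> to vanish. The growth bound counts time and distance alike, which
  is cruder than parabolic scaling but only affects the size of \<open>m\<close>.\<close>

lemma lap_pow_eq_zero:
  assumes u: "ancient_solution E w u" and t0: "t0 \<le> 0"
    and vol: "\<And>R. R \<ge> 1 \<Longrightarrow> (\<Sum>x\<in>gball E p R. vdeg E w x) \<le> C * (1 + R) powr \<alpha>"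
    and growth: "\<And>x t. t \<le> 0 \<Longrightarrow> \<bar>u x t\<bar> \<le> Q * (1 + real (gdist E x p) + \<bar>t\<bar>) powr q"
    and "C \<ge> 0" "\<alpha> \<ge> 0" "q \<ge> 0" and m: "\<alpha> + 4 * q < real (4 * m)" "m > 0"
  shows "lap_pow m (\<lambda>y. u y t0) x = 0"
proof (cases "\<exists>y. adj E x y")
  case False
  then show ?thesis
    using m(2) by (cases m) (auto simp: laplacian_def)
next
  case True
  then have "vdeg E w x > 0"
    using vdeg_pos by blast
  define n where "n = 2 * m"
  (* With this radius the innermost cutoff, of index n + 1, has parameter 2 and is therefore one on
     the ball of radius R, which contains x. *)
  define c where "c = 2 * real n + 4"
  define v where "v = lap_pow m (\<lambda>y. u y t0) x"
  have Q: "Q \<ge> 0"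
    using growth[of 0 p] by simp
  have "coef n * (vdeg E w x * v\<^sup>2) \<le> 0"
  proof (rule nonpos_if_power_le_powr)
    show "\<alpha> + 4 * q < real (2 * n)"
      using m by (simp add: n_def)
    fix R assume R': "max 1 (real (gdist E x p)) \<le> R"
    then have R: "R \<ge> 1" "R > 0"
      by auto
    define S where "S = gball E p ((c + 1) * R)"
    define \<psi> where "\<psi> j x = (cutoff p R (c - 2 * real j) x)\<^sup>2" for j x
    define a where "a = t0 - R\<^sup>2"
    define M where "M = C * (1 + (c + 1) * R) powr \<alpha> * (Q * (1 + (c + 1) * R + \<bar>t0\<bar> + R\<^sup>2) powr q)\<^sup>2"
    define En where "En j i t = energy j S (\<psi> i) (\<lambda>y. u y t)" for j i t
    define F where "F \<tau> = (\<Sum>j\<le>n. coef j * (\<tau> - a) ^ j * En j (Suc j) \<tau>)" for \<tau>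
    have cR: "(c + 1) * R \<ge> 1 * 1"
      using R by (intro mult_mono) (auto simp: c_def)
    have finS: "finite S"
      by (simp add: S_def finite_gball)
    have En_nonneg: "En j i t \<ge> 0" for j i t
      unfolding En_def by (intro energy_nonneg) (simp add: \<psi>_def)
    have EnM: "En 0 i t \<le> M" if t: "a \<le> t" "t \<le> t0" for i t
    proof -
      have "En 0 i t = (\<Sum>x\<in>S. vdeg E w x * (\<psi> i x * (u x t)\<^sup>2))"
        by (simp add: En_def energy_def Let_def mult.assoc)
      also have "\<dots> \<le> (\<Sum>x\<in>S. vdeg E w x * (1 * (Q * (1 + (c + 1) * R + \<bar>t0\<bar> + R\<^sup>2) powr q)\<^sup>2))"
      proof (intro sum_mono mult_left_mono mult_mono)
        fix x assume x: "x \<in> S"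
        show "\<psi> i x \<le> 1"
          by (simp add: \<psi>_def cutoff_bounds power_le_one)
        have "\<bar>u x t\<bar> \<le> Q * (1 + real (gdist E x p) + \<bar>t\<bar>) powr q"
          using growth t t0 by simp
        also have "\<dots> \<le> Q * (1 + (c + 1) * R + \<bar>t0\<bar> + R\<^sup>2) powr q"
          using x t t0 Q assms(7) by (intro mult_left_mono powr_mono2) (auto simp: S_def gball_def a_def)
        finally show "(u x t)\<^sup>2 \<le> (Q * (1 + (c + 1) * R + \<bar>t0\<bar> + R\<^sup>2) powr q)\<^sup>2"
          by (rule abs_le_square_iff[THEN iffD1, OF order.trans]) simp
      qed (auto simp: vdeg_nonneg)
      also have "\<dots> = (\<Sum>x\<in>S. vdeg E w x) * (Q * (1 + (c + 1) * R + \<bar>t0\<bar> + R\<^sup>2) powr q)\<^sup>2"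
        by (simp add: sum_distrib_right)
      also have "\<dots> \<le> M"
        unfolding M_def S_def using vol[of "(c + 1) * R"] cR by (intro mult_right_mono) auto
      finally show ?thesis .
    qed
    have "F t0 \<le> F a + 4 / R\<^sup>2 * M * (t0 - a)"
    proof (rule increment_le_of_deriv_le)
      fix t assume t: "a \<le> t" "t \<le> t0"
      have "\<exists>D. (F has_real_derivative D) (at t within {..0}) \<and>
          D \<le> 4 / R\<^sup>2 * En 0 0 t - (1/2) * (coef n * (t - a) ^ n) * En (Suc n) (Suc n) t"
        unfolding F_def En_def
        by (rule functional_deriv[OF u _ R(1) S_def]) (use t t0 in \<open>auto simp: \<psi>_def a_def\<close>)
      then obtain D where D: "(F has_real_derivative D) (at t within {..0})"
        "D \<le> 4 / R\<^sup>2 * En 0 0 t - (1/2) * (coef n * (t - a) ^ n) * En (Suc n) (Suc n) t"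
        by blast
      moreover have "0 \<le> (1/2) * (coef n * (t - a) ^ n) * En (Suc n) (Suc n) t"
        using t coef_simps(3)[of n] En_nonneg by (intro mult_nonneg_nonneg) auto
      moreover have "4 / R\<^sup>2 * En 0 0 t \<le> 4 / R\<^sup>2 * M"
        using EnM[OF t] by (intro mult_left_mono) auto
      ultimately show "\<exists>D. (F has_real_derivative D) (at t within {..0}) \<and> D \<le> 4 / R\<^sup>2 * M"
        by (intro exI[of _ D]) linarith
    qed (use t0 in \<open>auto simp: a_def\<close>)
    also have "4 / R\<^sup>2 * M * (t0 - a) = 4 * M"
      using R by (simp add: a_def)
    (* At the initial time only the term with the zeroth power of the elapsed time survives. *)
    also have "F a = En 0 (Suc 0) a"
      unfolding F_def by (subst sum.atMost_shift) (simp add: coef_simps)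
    also have "\<dots> \<le> M"
      by (rule EnM) (auto simp: a_def)
    finally have "F t0 \<le> 5 * M"
      by simp
    have "coef n * (vdeg E w x * v\<^sup>2) * R ^ (2 * n) = coef n * (t0 - a) ^ n * (vdeg E w x * v\<^sup>2)"
      by (simp add: a_def power_mult)
    also have "vdeg E w x * v\<^sup>2 \<le> En n (Suc n) t0"
    proof -
      have "real (gdist E x p) / R \<le> 1"
        using R' R by (simp add: field_simps)
      then have "\<psi> (Suc n) x = 1"
        by (simp add: \<psi>_def cutoff_def c_def)
      moreover have "x \<in> S"
      proof -
        have "1 * R \<le> (c + 1) * R"
          using R by (intro mult_right_mono) (auto simp: c_def)
        with R' have "real (gdist E x p) \<le> (c + 1) * R"
          by linarith
        then show ?thesis
          by (simp add: S_def gball_def)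
      qed
      then have "vdeg E w x * \<psi> (Suc n) x * v\<^sup>2
          \<le> (\<Sum>x\<in>S. vdeg E w x * \<psi> (Suc n) x * (lap_pow m (\<lambda>y. u y t0) x)\<^sup>2)"
        unfolding v_def
        by (intro member_le_sum[of x S "\<lambda>x. vdeg E w x * \<psi> (Suc n) x * (lap_pow m (\<lambda>y. u y t0) x)\<^sup>2"])
          (auto simp: finS \<psi>_def vdeg_nonneg)
      ultimately show ?thesis
        by (simp add: En_def energy_def n_def Let_def)
    qed
    then have "coef n * (t0 - a) ^ n * (vdeg E w x * v\<^sup>2) \<le> coef n * (t0 - a) ^ n * En n (Suc n) t0"
      using coef_simps(3)[of n] by (intro mult_left_mono) (auto simp: a_def)
    also have "\<dots> \<le> F t0"
      unfolding F_def
      by (rule member_le_sum[of n "{..n}" "\<lambda>j. coef j * (t0 - a) ^ j * En j (Suc j) t0"])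
        (auto simp: a_def En_nonneg less_imp_le[OF coef_simps(3)])
    also have "\<dots> \<le> 5 * M"
      by fact
    also have "M \<le> C * ((c + 2) * R) powr \<alpha> * (Q * ((c + 3 + \<bar>t0\<bar>) * R\<^sup>2) powr q)\<^sup>2"
    proof -
      have "c \<ge> 0" "R \<le> R\<^sup>2" "1 \<le> R\<^sup>2"
        using R by (auto simp: c_def intro: self_le_power)
      then have "1 + (c + 1) * R \<le> (c + 2) * R" "c * R \<le> c * R\<^sup>2" "\<bar>t0\<bar> * 1 \<le> \<bar>t0\<bar> * R\<^sup>2" "c * R \<ge> 0"
        using R \<open>1 \<le> R\<^sup>2\<close> mult_left_mono[OF \<open>1 \<le> R\<^sup>2\<close>, of "\<bar>t0\<bar>"]
        by (auto simp: distrib_right intro!: mult_left_mono)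
      moreover from this have "1 + (c + 1) * R + \<bar>t0\<bar> + R\<^sup>2 \<le> (c + 3 + \<bar>t0\<bar>) * R\<^sup>2"
        using \<open>R \<le> R\<^sup>2\<close> \<open>1 \<le> R\<^sup>2\<close> unfolding distrib_right by linarith
      ultimately show ?thesis
        unfolding M_def using assms(5-7) Q R \<open>c \<ge> 0\<close>
        by (intro mult_mono power_mono powr_mono2 mult_nonneg_nonneg) (auto intro: order.trans)
    qed
    also have "\<dots> = C * (c + 2) powr \<alpha> * Q\<^sup>2 * ((c + 3 + \<bar>t0\<bar>) powr q)\<^sup>2 * R powr (\<alpha> + 4 * q)"
    proof -
      have "((R\<^sup>2) powr q)\<^sup>2 = R powr (4 * q)"
        using R by (simp add: powr_power powr_powr flip: powr_numeral)
      moreover have "((c + 2) * R) powr \<alpha> = (c + 2) powr \<alpha> * R powr \<alpha>"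
        "((c + 3 + \<bar>t0\<bar>) * R\<^sup>2) powr q = (c + 3 + \<bar>t0\<bar>) powr q * (R\<^sup>2) powr q"
        using R by (auto simp: c_def intro!: powr_mult)
      ultimately show ?thesis
        by (simp add: power_mult_distrib powr_add)
    qed
    finally show "coef n * (vdeg E w x * v\<^sup>2) * R ^ (2 * n)
        \<le> 5 * (C * (c + 2) powr \<alpha> * Q\<^sup>2 * ((c + 3 + \<bar>t0\<bar>) powr q)\<^sup>2) * R powr (\<alpha> + 4 * q)"
      by simp
  qed
  then have "v\<^sup>2 \<le> 0"
    using coef_simps(3)[of n] \<open>vdeg E w x > 0\<close> by (auto simp: mult_le_0_iff)
  then show ?thesis
    by (simp add: v_def)
qed

section \<open>Ancient solutions that are polynomial in time\<close>

text \<open>Taylor's formula at time zero, by induction: \<open>\<Delta> u = \<partial>\<^sub>t u\<close> is again an ancient solution, annihilated by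
  one power of \<open>\<Delta>\<close> less, and integrating its expansion gives that of \<open>u\<close>.\<close>

lemma ancient_eq_polynomial:
  assumes "ancient_solution E w u" "\<And>x t. t \<le> 0 \<Longrightarrow> lap_pow m (\<lambda>y. u y t) x = 0" "t \<le> 0"
  shows "u x t = (\<Sum>j<m. lap_pow j (\<lambda>y. u y 0) x / fact j * t ^ j)"
  using assms
proof (induction m arbitrary: u x t)
  case 0
  then show ?case by simp
next
  case (Suc m)
  define v where "v = (\<lambda>x t. laplacian E w (\<lambda>y. u y t) x)"
  have v_pow: "lap_pow j (\<lambda>y. v y t) = lap_pow (Suc j) (\<lambda>y. u y t)" for j t
    by (simp add: v_def funpow_swap1)
  have "ancient_solution E w v"
    unfolding ancient_solution_def
  proof (intro allI impI)
    fix x t assume "(t::real) \<le> 0"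
    from lap_pow_deriv[OF Suc.prems(1) this, of 1 x]
    show "(v x has_real_derivative laplacian E w (\<lambda>y. v y t) x) (at t within {..0})"
      by (simp add: v_def)
  qed
  then have v: "v x t = (\<Sum>j<m. lap_pow (Suc j) (\<lambda>y. u y 0) x / fact j * t ^ j)" if "t \<le> 0" for x t
    using Suc.IH[of v t x] Suc.prems(2) that unfolding v_pow by blast
  define h where "h = (\<lambda>s. u x s - (\<Sum>j<m. lap_pow (Suc j) (\<lambda>y. u y 0) x / fact (Suc j) * s ^ Suc j))"
  have summand: "((\<lambda>s. A / fact (Suc j) * s ^ Suc j) has_real_derivative A / fact j * s ^ j) (at s within {..0})"
    for A s :: real and j
    by (rule derivative_eq_intros refl)+ (simp add: field_simps del: of_nat_Suc)
  have "(h has_real_derivative 0) (at s within {..0})" if "s \<in> {..0}" for s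
  proof -
    have "(u x has_real_derivative v x s) (at s within {..0})"
      using Suc.prems(1) that by (auto simp: ancient_solution_def v_def)
    then have "(h has_real_derivative v x s - (\<Sum>j<m. lap_pow (Suc j) (\<lambda>y. u y 0) x / fact j * s ^ j)) (at s within {..0})"
      unfolding h_def by (intro DERIV_diff DERIV_sum summand)
    then show ?thesis
      using v[of s x] that by simp
  qed
  then obtain b where b: "\<And>s. s \<in> {..0} \<Longrightarrow> h s = b"
    using has_field_derivative_zero_constant[of "{..0::real}" h] by auto
  have "h t = h 0"
    using b[of t] b[of 0] Suc.prems(3) by simp
  then have "u x t = u x 0 + (\<Sum>j<m. lap_pow (Suc j) (\<lambda>y. u y 0) x / fact (Suc j) * t ^ Suc j)"
    by (simp add: h_def)
  also have "\<dots> = (\<Sum>j<Suc m. lap_pow j (\<lambda>y. u y 0) x / fact j * t ^ j)"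
    by (subst sum.lessThan_Suc_shift) simp
  finally show ?case .
qed

section \<open>Spaces of polynomial growth\<close>

text \<open>Unlike in \<open>harmonic_space\<close>, the centre is fixed, which makes the vector space structure evident.\<close>

definition poly_growth :: "'v \<Rightarrow> real \<Rightarrow> ('v \<Rightarrow> real) set" where
  "poly_growth p q = {f. \<exists>C. \<forall>x. \<bar>f x\<bar> \<le> C * (1 + real (gdist E x p)) powr q}"

lemma subspace_poly_growth: "subspace (poly_growth p q)"
proof (rule subspaceI)
  show "0 \<in> poly_growth p q"
    by (auto simp: poly_growth_def intro: exI[of _ 0])
next
  fix f g assume "f \<in> poly_growth p q" "g \<in> poly_growth p q"
  then obtain A B where "\<bar>f x\<bar> \<le> A * (1 + real (gdist E x p)) powr q"
    "\<bar>g x\<bar> \<le> B * (1 + real (gdist E x p)) powr q" for x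
    unfolding poly_growth_def by blast
  then have "\<bar>(f + g) x\<bar> \<le> (A + B) * (1 + real (gdist E x p)) powr q" for x
    unfolding plus_fun_apply distrib_right by (meson abs_triangle_ineq add_mono order.trans)
  then show "f + g \<in> poly_growth p q"
    unfolding poly_growth_def by blast
next
  fix c :: real and f assume "f \<in> poly_growth p q"
  then obtain A where A: "\<bar>f x\<bar> \<le> A * (1 + real (gdist E x p)) powr q" for x
    unfolding poly_growth_def by blast
  have "\<bar>(c *\<^sub>R f) x\<bar> \<le> (\<bar>c\<bar> * A) * (1 + real (gdist E x p)) powr q" for x
    using mult_left_mono[OF A[of x], of "\<bar>c\<bar>"] by (simp add: scaleR_fun_def abs_mult mult.assoc)
  then show "c *\<^sub>R f \<in> poly_growth p q"
    unfolding poly_growth_def by blast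
qed

lemma laplacian_poly_growth:
  assumes "f \<in> poly_growth p q" "q \<ge> 0"
  shows "laplacian E w f \<in> poly_growth p q"
proof -
  obtain A where A: "\<bar>f x\<bar> \<le> A * (1 + real (gdist E x p)) powr q" for x
    using assms(1) unfolding poly_growth_def by blast
  have "A \<ge> 0"
    using A[of p] by simp
  have "\<bar>laplacian E w f x\<bar> \<le> (2 * A * 2 powr q) * (1 + real (gdist E x p)) powr q" for x
  proof -
    have *: "\<bar>f y\<bar> \<le> A * (2 * (1 + real (gdist E x p))) powr q" if "gdist E y p \<le> Suc (gdist E x p)" for y
    proof -
      have "real (gdist E y p) \<le> real (gdist E x p) + 1"
        using that by linarith
      then have "1 + real (gdist E y p) \<le> 2 * (1 + real (gdist E x p))"
        by simp
      then show ?thesis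
        using \<open>A \<ge> 0\<close> assms(2)
        by (intro order.trans[OF A[of y]] mult_left_mono powr_mono2) auto
    qed
    have "\<bar>laplacian E w f x\<bar> \<le> 2 * (A * (2 * (1 + real (gdist E x p))) powr q)"
    proof (intro abs_laplacian_le *)
      show "gdist E y p \<le> Suc (gdist E x p)" if "adj E x y" for y
        using gdist_adj[of y x p] adj_commute[of x y] that by simp
    qed simp
    also have "(2 * (1 + real (gdist E x p))) powr q = 2 powr q * (1 + real (gdist E x p)) powr q"
      by (rule powr_mult)
    finally show ?thesis
      by (simp add: mult.assoc)
  qed
  then show ?thesis
    unfolding poly_growth_def by blast
qed

lemma harmonic_poly_growth:
  assumes "f \<in> poly_growth p q" "laplacian E w f = 0" "q \<ge> 0"
  shows "f \<in> harmonic_space E w q"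
proof -
  obtain A where A: "\<bar>f x\<bar> \<le> A * (1 + real (gdist E x p)) powr q" for x
    using assms(1) unfolding poly_growth_def by blast
  have "A \<ge> 0"
    using A[of p] by simp
  have "(SUP x\<in>gball E p R. ereal \<bar>f x\<bar>) \<le> ereal (A * (1 + R) powr q)" if "R \<ge> 1" for R
  proof (rule SUP_least)
    fix x assume "x \<in> gball E p R"
    then have "A * (1 + real (gdist E x p)) powr q \<le> A * (1 + R) powr q"
      using \<open>A \<ge> 0\<close> assms(3) by (intro mult_left_mono powr_mono2) (auto simp: gball_def)
    then show "ereal \<bar>f x\<bar> \<le> ereal (A * (1 + R) powr q)"
      using A[of x] by simp
  qed
  then show ?thesis
    using assms(2) by (auto simp: harmonic_space_def harmonic_def)
qed

lemma ancient_space_bound: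
  assumes "u \<in> ancient_space E w q"
  shows "\<exists>b C. C \<ge> 0 \<and> (\<forall>R x t. R \<ge> 1 \<longrightarrow> real (gdist E x b) \<le> R \<longrightarrow> - (R\<^sup>2) \<le> t \<longrightarrow> t \<le> 0 \<longrightarrow>
    \<bar>u x t\<bar> \<le> C * (1 + R) powr q)"
proof -
  obtain b C where *: "\<And>R. R \<ge> 1 \<Longrightarrow> (SUP (x, t)\<in>gball E b R \<times> {- (R\<^sup>2)..0}. ereal \<bar>u x t\<bar>)
                        \<le> ereal (C * (1 + R) powr q)"
    using assms unfolding ancient_space_def by blast
  have bound: "\<bar>u x t\<bar> \<le> C * (1 + R) powr q"
    if "R \<ge> 1" "real (gdist E x b) \<le> R" "- (R\<^sup>2) \<le> t" "t \<le> 0" for R x t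
  proof -
    have "(x, t) \<in> gball E b R \<times> {- (R\<^sup>2)..0}"
      using that by (simp add: gball_def)
    from order.trans[OF SUP_upper[OF this] *[OF that(1)]] show ?thesis
      by simp
  qed
  have "0 \<le> C * (1 + 1) powr q"
    using bound[of 1 b 0] by simp
  then have "C \<ge> 0"
    by (simp add: zero_le_mult_iff)
  then show ?thesis
    using bound by (intro exI[of _ b] exI[of _ C]) simp
qed

text \<open>A bound with an arbitrary centre \<open>p\<close>, obtained from the ball of radius
  \<open>1 + gdist E x b + \<bar>t\<bar>\<close> about the given centre \<open>b\<close>; moving the centre only changes the constant.\<close>

lemma ancient_space_growth:
  assumes "u \<in> ancient_space E w q" "q \<ge> 0"
  shows "\<exists>Q. \<forall>x t. t \<le> 0 \<longrightarrow> \<bar>u x t\<bar> \<le> Q * (1 + real (gdist E x p) + \<bar>t\<bar>) powr q"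
proof -
  obtain b C where C: "C \<ge> 0" and bound: "\<forall>R x t. R \<ge> 1 \<longrightarrow> real (gdist E x b) \<le> R \<longrightarrow> - (R\<^sup>2) \<le> t \<longrightarrow> t \<le> 0 \<longrightarrow>
    \<bar>u x t\<bar> \<le> C * (1 + R) powr q"
    using ancient_space_bound[OF assms(1)] by (elim exE conjE)
  define D where "D = real (gdist E p b)"
  have "\<bar>u x t\<bar> \<le> C * (2 + D) powr q * (1 + real (gdist E x p) + \<bar>t\<bar>) powr q" if t: "t \<le> 0" for x t
  proof -
    define R where "R = 1 + real (gdist E x b) + \<bar>t\<bar>"
    have R: "R \<ge> 1" "\<bar>t\<bar> \<le> R" "R \<le> R\<^sup>2"
      using self_le_power[of R 2] by (auto simp: R_def)
    have "\<bar>u x t\<bar> \<le> C * (1 + R) powr q"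
      using R t by (intro bound[rule_format]) (auto simp: R_def)
    also have "\<dots> \<le> C * ((2 + D) * (1 + real (gdist E x p) + \<bar>t\<bar>)) powr q"
    proof (intro mult_left_mono powr_mono2 C assms(2))
      have "real (gdist E x b) \<le> real (gdist E x p) + D"
        using gdist_triangle[of x b p] by (simp add: D_def)
      moreover have "0 \<le> D * real (gdist E x p)" "0 \<le> D * \<bar>t\<bar>"
        by (simp_all add: D_def)
      ultimately show "1 + R \<le> (2 + D) * (1 + real (gdist E x p) + \<bar>t\<bar>)"
        by (simp add: R_def algebra_simps)
    qed (simp add: R_def)
    also have "\<dots> = C * (2 + D) powr q * (1 + real (gdist E x p) + \<bar>t\<bar>) powr q"
      by (simp add: powr_mult D_def)
    finally show ?thesis .
  qed
  then show ?thesis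
    by blast
qed

text \<open>The exponential series \<open>exp (t * \<Delta>) f\<close> cut off after \<open>n\<close> terms; it solves the heat equation when
  \<open>\<Delta> ^ n f = 0\<close>.\<close>

definition heat_extension :: "nat \<Rightarrow> ('v \<Rightarrow> real) \<Rightarrow> 'v \<Rightarrow> real \<Rightarrow> real" where
  "heat_extension n f = (\<lambda>x t. if t \<le> 0 then \<Sum>j<n. lap_pow j f x / fact j * t ^ j else 0)"

lemma linear_heat_extension: "linear (heat_extension n)"
proof (rule linearI)
  note L = linear_funpow[OF linear_laplacian]
  show "heat_extension n (f + g) = heat_extension n f + heat_extension n g" for f g
    by (auto simp: heat_extension_def fun_eq_iff linear_add[OF L] sum.distrib[symmetric] add_divide_distrib distrib_right)
  show "heat_extension n (c *\<^sub>R f) = c *\<^sub>R heat_extension n f" for c f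
    unfolding heat_extension_def linear_scale[OF L]
    by (auto simp: fun_eq_iff scaleR_fun_def sum_distrib_left mult.assoc)
qed

text \<open>Every solution in the space is a polynomial in time, whose coefficients are determined by the
  values \<open>f\<close> at time zero. At a fixed vertex the growth bound on \<open>t = - R\<^sup>2\<close> allows no power of \<open>t\<close>
  above \<open>k\<close>, hence none from \<open>n\<close> on.\<close>

lemma ancient_space_subset:
  assumes vol: "\<And>R. R \<ge> 1 \<Longrightarrow> (\<Sum>x\<in>gball E p R. vdeg E w x) \<le> C * (1 + R) powr \<alpha>"
    and "C \<ge> 0" "\<alpha> \<ge> 0" "k \<ge> 0" and n: "k < real n"
  shows "ancient_space E w (2 * k) \<subseteq>
    heat_extension n ` {f \<in> poly_growth p (2 * k). lap_pow n f = 0}"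
proof
  fix u assume u: "u \<in> ancient_space E w (2 * k)"
  then have anc: "ancient_solution E w u" and pos: "\<And>x t. t > 0 \<Longrightarrow> u x t = 0"
    by (auto simp: ancient_space_def)
  have k: "2 * k \<ge> 0"
    using assms by simp
  obtain Q where Q: "\<forall>x t. t \<le> 0 \<longrightarrow> \<bar>u x t\<bar> \<le> Q * (1 + real (gdist E x p) + \<bar>t\<bar>) powr (2 * k)"
    using ancient_space_growth[OF u k, of p] by (elim exE)
  define f where "f = (\<lambda>y. u y 0)"
  have f: "f \<in> poly_growth p (2 * k)"
    unfolding f_def poly_growth_def using Q[rule_format, of 0] by auto
  (* A power of the Laplacian high enough to vanish by the energy estimate; the sharp power n is
     found only afterwards. *)
  define m where "m = nat \<lceil>\<alpha> + 8 * k\<rceil> + n + 1"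
  have m: "\<alpha> + 4 * (2 * k) < real (4 * m)" "n < m"
    using assms by (auto simp: m_def) linarith
  have poly: "u x t = (\<Sum>j<m. lap_pow j f x / fact j * t ^ j)" if "t \<le> 0" for x t
    unfolding f_def
  proof (rule ancient_eq_polynomial[OF anc _ that])
    fix x and t :: real assume "t \<le> 0"
    then show "lap_pow m (\<lambda>y. u y t) x = 0"
      using m assms k by (intro lap_pow_eq_zero[OF anc _ vol Q[rule_format]]) auto
  qed
  have vanish: "lap_pow j f x = 0" if j: "n \<le> j" "j < m" for j x
  proof -
    obtain b A where A: "A \<ge> 0" and bound: "\<forall>R x t. R \<ge> 1 \<longrightarrow> real (gdist E x b) \<le> R \<longrightarrow> - (R\<^sup>2) \<le> t \<longrightarrow> t \<le> 0 \<longrightarrow>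
        \<bar>u x t\<bar> \<le> A * (1 + R) powr (2 * k)"
      using ancient_space_bound[OF u] by (elim exE conjE)
    define d where "d = real (gdist E x b)"
    have "lap_pow j f x / fact j = 0"
    proof (rule coeff_zero_above_growth[where m = m and k = k])
      fix R :: real assume R: "R \<ge> 1"
      have "\<bar>u x (- (R\<^sup>2))\<bar> \<le> A * (1 + max R d) powr (2 * k)"
      proof (intro bound[rule_format])
        show "- ((max R d)\<^sup>2) \<le> - (R\<^sup>2)"
          using R by (simp add: power_mono)
      qed (use R in \<open>auto simp: d_def\<close>)
      also have "\<dots> \<le> A * ((1 + d) * (1 + R)) powr (2 * k)"
      proof (intro mult_left_mono powr_mono2 A k)
        have "0 \<le> d * R" "d \<ge> 0"
          using R by (auto simp: d_def)
        then show "1 + max R d \<le> (1 + d) * (1 + R)" "0 \<le> 1 + max R d"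
          using R by (auto simp: algebra_simps max_def)
      qed
      also have "\<dots> = A * (1 + d) powr (2 * k) * (1 + R) powr (2 * k)"
        using R by (simp add: powr_mult d_def)
      finally show "\<bar>\<Sum>j<m. lap_pow j f x / fact j * (- (R\<^sup>2)) ^ j\<bar>
          \<le> A * (1 + d) powr (2 * k) * (1 + R) powr (2 * k)"
        using poly[of "- (R\<^sup>2)" x] by simp
    qed (use j n assms in auto)
    then show ?thesis
      by simp
  qed
  have "u = heat_extension n f"
  proof (intro ext)
    fix x t
    show "u x t = heat_extension n f x t"
    proof (cases "t \<le> 0")
      case True
      have "u x t = (\<Sum>j<n. lap_pow j f x / fact j * t ^ j)"
        unfolding poly[OF True] using m(2) vanish by (intro sum.mono_neutral_right) auto
      then show ?thesis
        using True by (simp add: heat_extension_def)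
    qed (simp add: heat_extension_def pos)
  qed
  moreover have "lap_pow n f = 0"
    using vanish[of n] m(2) by (simp add: fun_eq_iff)
  ultimately show "u \<in> heat_extension n ` {f \<in> poly_growth p (2 * k). lap_pow n f = 0}"
    using f by blast
qed

lemma sum_vdeg_le_of_vol_le:
  assumes "vol E w (gball E p R) \<le> ennreal B" "B \<ge> 0"
  shows "(\<Sum>x\<in>gball E p R. vdeg E w x) \<le> B"
proof -
  have "vol E w (gball E p R) = ennreal (\<Sum>x\<in>gball E p R. vdeg E w x)"
    by (simp add: vol_def finite_gball vdeg_nonneg)
  then show ?thesis
    using assms by simp
qed

end

section \<open>The dimension bound\<close>

theorem theorem1p2:
  fixes E :: "'v set set" and w :: "'v set \<Rightarrow> real" and x0 :: 'v and \<alpha> C k :: real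
  assumes "weighted_graph E w"
    and "\<alpha> > 0" and "C > 0"
    and "\<forall>R::real. R \<ge> 1 \<longrightarrow> vol E w (gball E x0 R) \<le> ennreal (C * (1 + R) powr \<alpha>)"
    and "k \<ge> 1"
  shows "ereal_of_enat (edim (ancient_space E w (2 * k)))
           \<le> ereal (k + 1) * ereal_of_enat (edim (harmonic_space E w (2 * k)))"
proof (cases "edim (harmonic_space E w (2 * k))")
  case infinity
  then show ?thesis
    using \<open>k \<ge> 1\<close> by simp
next
  case (enat h)
  interpret weighted_graph E w
    by fact
  obtain H where H: "finite H" "card H = h" "harmonic_space E w (2 * k) \<subseteq> span H"
    using edim_finite_spanned[OF enat] by blast
  let ?G = "poly_growth x0 (2 * k)"
  define n where "n = nat \<lfloor>k\<rfloor> + 1"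
  have n: "k < real n" "real n \<le> k + 1"
    using \<open>k \<ge> 1\<close> by (auto simp: n_def) linarith
  have "\<exists>B. finite B \<and> card B \<le> n * card H \<and> {f \<in> ?G. lap_pow n f = 0} \<subseteq> span B"
  proof (rule span_iterated_kernel[OF linear_laplacian subspace_poly_growth _ H(1)])
    show "laplacian E w ` ?G \<subseteq> ?G"
      using laplacian_poly_growth \<open>k \<ge> 1\<close> by auto
    show "{f \<in> ?G. laplacian E w f = 0} \<subseteq> span H"
      using harmonic_poly_growth[of _ x0 "2 * k"] \<open>k \<ge> 1\<close> H(3) by auto
  qed
  then obtain B where B: "finite B" "card B \<le> n * h" "{f \<in> ?G. lap_pow n f = 0} \<subseteq> span B"
    unfolding H(2) by (elim exE conjE)
  have "ancient_space E w (2 * k) \<subseteq> heat_extension n ` {f \<in> ?G. lap_pow n f = 0}"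
    by (rule ancient_space_subset[of x0 C \<alpha> k]) (use assms n sum_vdeg_le_of_vol_le in auto)
  also have "\<dots> \<subseteq> heat_extension n ` span B"
    using B(3) by blast
  also have "\<dots> = span (heat_extension n ` B)"
    by (simp add: linear_span_image linear_heat_extension)
  finally have "edim (ancient_space E w (2 * k)) \<le> enat (card (heat_extension n ` B))"
    using B(1) by (intro edim_le_card) auto
  also have "\<dots> \<le> enat (n * h)"
    using card_image_le[OF B(1), of "heat_extension n"] B(2) by simp
  finally have "ereal_of_enat (edim (ancient_space E w (2 * k))) \<le> ereal_of_enat (enat (n * h))"
    by (simp only: ereal_of_enat_le_iff)
  also have "\<dots> \<le> ereal (k + 1) * ereal_of_enat (enat h)"
    using n(2) by (simp add: mult_right_mono)
  finally show ?thesis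
    by (simp add: enat)
qed

end
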